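(* Let $N=\{1,\dots,n\}$ be a finite set of agents, $A$ a non-empty finite set of objects, and $\succ_A=(\succ_a)_{a\in A}$ a priority structure. On the domain $\mathbb{L}^n(A)$ (every object acceptable to every agent), the FPTTC rule $T^{\succ_A}$ is SOSP-implementable if and only if it is a weak serial dictatorship.
   Context: **Setting.** $N=\{1,\dots,n\}$ is a finite set of agents, $A$ a non-empty finite set of objects, and $a_0\notin A$ the outside option. An allocation is a function $\mu:N\to A\cup\{a_0\}$ with $|\mu^{-1}(a)|\le 1$ for all $a\in A$; $\mathcal{M}$ is the set of allocations. For a finite set $X$, $\mathbb{L}(X)$ is the set of strict linear orders on $X$; a preference is an element $P$ of $\mathbb{L}(A\cup\{a_0\})$, with weak part $R$ ($x\,R\,y$ iff $x\,P\,y$ or $x=y$). By abuse of notation, $\mathbb{L}(A)=\{P\in\mathbb{L}(A\cup\{a_0\}) : a\,P\,a_0 \text{ for all } a\in A\}$, and $\mathbb{L}^n(A)$ is its $n$-fold product. A domain is a product $\mathcal{P}_N=\prod_{i\in N}\mathcal{P}_i$ with $\mathcal{P}_i\subseteq\mathbb{L}(A\cup\{a_0\})$; an assignment rule is a function $f:\mathcal{P}_N\to\mathcal{M}$, and $f_i(P_N)$ is agent $i$'s assignment. Object $a$ is acceptable to $i$ if $a\,P_i\,a_0$. A priority structure is a collection $\succ_A=(\succ_a)_{a\in A}$ with $\succ_a\in\mathbb{L}(N)$; $\tau(\succ,N')$ is the $\succ$-maximal agent in $N'\subseteq N$. **FPTTC rule.** The fixed priority top trading cycles (FPTTC) rule $T^{\succ_A}$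 associated with $\succ_A$ is computed at a profile $P_N$ in steps. At Step $s$, let $N_s(P_N)$ and $A_s(P_N)$ be the sets of agents and objects remaining after Step $s-1$ (so $N_1(P_N)=N$, $A_1(P_N)=A$). Each $a\in A_s(P_N)$ is owned by $\tau(\succ_a,N_s(P_N))$. Form the directed graph on $N_s(P_N)$ in which each agent $i$ points to the owner of her most preferred acceptable object in $A_s(P_N)$, or to herself if no object in $A_s(P_N)$ is acceptable to her. Each agent in a cycle of this graph (self-loops included) is assigned her most preferred element of $A_s(P_N)\cup\{a_0\}$; assigned agents and assigned objects are removed. The procedure is repeated until all agents or all objects are assigned; any agent unassigned at the end receives $a_0$. **Weak serial dictatorship.** $T^{\succ_A}$ is a weak serial dictatorship if for all $P_N\in\mathbb{L}^n(A)$ and every step $s$ of the procedure at $P_N$: if $|A_s(P_N)|>2$, then the set of owners $\{\tau(\succ_a,N_s(P_N)) : a\in A_s(P_N)\}$ has exactly one element. **Mechanisms.** For a rooted directed tree $T$, let $V(T),E(T),r(T),L(T)$ denote its nodes, edges, root and leaves; $E^{out}(v)$ the outgoing edges of $v$; $s(e)$ the source of $e$. A mechanism on $\mathcal{P}_N$ is a tuple $G=\langle T,\eta^{LA},\eta^{NA},\eta^{EP}\rangle$ where $T$ is a rooted tree, $\eta^{LA}:L(T)\to\mathcal{M}$, $\eta^{NA}:V(T)\setminus L(T)\to N$, and $\eta^{EP}:E(T)\to 2^{\mathbb{L}(A\cup\{a_0\})}\setminus\{\emptyset\}$ such that (a) $\eta^{EP}(e)\cap\eta^{EP}(e')=\emptyset$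 for distinct $e,e'$ with $s(e)=s(e')$; (b) for each $v\in V(T)\setminus L(T)$: if on the path $(v^1,\dots,v^t)$ from $r(T)$ to $v$ there is $t'<t$ with $\eta^{NA}(v^{t'})=\eta^{NA}(v)$ and $\eta^{NA}(v^{s})\ne\eta^{NA}(v)$ for $t'<s<t$, then $\bigcup_{e\in E^{out}(v)}\eta^{EP}(e)=\eta^{EP}(v^{t'},v^{t'+1})$; otherwise $\bigcup_{e\in E^{out}(v)}\eta^{EP}(e)=\mathcal{P}_{\eta^{NA}(v)}$. Each $P_N\in\mathcal{P}_N$ determines a unique root-to-leaf path, following at each node $v$ the outgoing edge $e$ with $P_{\eta^{NA}(v)}\in\eta^{EP}(e)$; $P_N$ passes through the nodes of this path, and $f^G(P_N)=\eta^{LA}(l)$ where $l$ is its leaf. Preferences $P_i,P_i'$ diverge at $v$ if $\eta^{NA}(v)=i$ and they belong to $\eta^{EP}(e),\eta^{EP}(e')$ for two distinct $e,e'\in E^{out}(v)$. **SOSP.** $G$ is SOSP if for all $i\in N$, all $v$ with $\eta^{NA}(v)=i$, and all $P_N,P'_N,\tilde P_N\in\mathcal{P}_N$ passing through $v$ such that $P_i,P'_i$ do not diverge at $v$ and $P_i,\tilde P_i$ diverge at $v$, we have $f^G_i(P'_N)\,R_i\,f^G_i(\tilde P_N)$. An assignment rule $f$ on $\mathcal{P}_N$ is SOSP-implementable if $f=f^G$ for some SOSP mechanism $G$ on $\mathcal{P}_N$. *)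

theory Defs
  imports "HOL-Library.FuncSet" "Graph_Theory.Arc_Walk"
begin

text \<open>
  Agents are the elements of a finite type \<open>'n\<close>, objects those of a finite type \<open>'a\<close> (finite types
  are non-empty); \<open>A \<union> {a\<^sub>0}\<close> is \<open>'a option\<close>, with \<open>None\<close> the outside option \<open>a\<^sub>0\<close>.
  A strict linear order \<open>P\<close> is a relation, \<open>(x, y) \<in> P\<close> meaning that \<open>x\<close> is ranked above \<open>y\<close>.
\<close>

type_synonym 'a pref = "'a option rel"
type_synonym ('n, 'a) profile = "'n \<Rightarrow> 'a pref"
type_synonym ('n, 'a) assignment = "'n \<Rightarrow> 'a option"

definition linear_orders :: "'x rel set" where
  "linear_orders = {P. strict_linear_order P}"

definition all_acceptable :: "'a pref set" where
  "all_acceptable = {P \<in> linear_orders. \<forall>a. (Some a, None) \<in> P}"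

definition is_allocation :: "('n::finite, 'a) assignment \<Rightarrow> bool" where
  "is_allocation \<mu> \<longleftrightarrow> (\<forall>a. card (\<mu> -` {Some a}) \<le> 1)"

definition priority_structure :: "('a \<Rightarrow> 'n rel) \<Rightarrow> bool" where
  "priority_structure prio \<longleftrightarrow> (\<forall>a. prio a \<in> linear_orders)"

text \<open>The \<open>r\<close>-maximal element of \<open>X\<close>; meaningful for \<open>X\<close> finite and non-empty.\<close>

definition maximal :: "'x rel \<Rightarrow> 'x set \<Rightarrow> 'x" where
  "maximal r X = (THE x. x \<in> X \<and> (\<forall>y\<in>X. y \<noteq> x \<longrightarrow> (x, y) \<in> r))"


subsection \<open>Fixed priority top trading cycles\<close>

definition owner :: "('a \<Rightarrow> 'n rel) \<Rightarrow> 'n set \<Rightarrow> 'a \<Rightarrow> 'n" where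
  "owner prio N' a = maximal (prio a) N'"

definition points_to ::
  "('a \<Rightarrow> 'n rel) \<Rightarrow> ('n, 'a) profile \<Rightarrow> 'n set \<Rightarrow> 'a set \<Rightarrow> 'n \<Rightarrow> 'n" where
  "points_to prio P N' A' i =
     (if \<exists>a\<in>A'. (Some a, None) \<in> P i
      then owner prio N' (the (maximal (P i) {Some a | a. a \<in> A' \<and> (Some a, None) \<in> P i}))
      else i)"

definition pointing_graph ::
  "('a \<Rightarrow> 'n rel) \<Rightarrow> ('n, 'a) profile \<Rightarrow> 'n set \<Rightarrow> 'a set \<Rightarrow> 'n rel" where
  "pointing_graph prio P N' A' = {(i, points_to prio P N' A' i) | i. i \<in> N'}"

definition cycle_agents ::
  "('a \<Rightarrow> 'n rel) \<Rightarrow> ('n, 'a) profile \<Rightarrow> 'n set \<Rightarrow> 'a set \<Rightarrow> 'n set" where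
  "cycle_agents prio P N' A' = {i \<in> N'. (i, i) \<in> (pointing_graph prio P N' A')\<^sup>+}"

text \<open>
  A state consists of the remaining agents, the remaining objects, and the assignments made so far
  (\<open>None\<close> by default, so that agents who are never assigned end up with \<open>a\<^sub>0\<close>).
\<close>

type_synonym ('n, 'a) ttc_state = "'n set \<times> 'a set \<times> ('n, 'a) assignment"

definition ttc_step ::
  "('a \<Rightarrow> 'n rel) \<Rightarrow> ('n, 'a) profile \<Rightarrow> ('n, 'a) ttc_state \<Rightarrow> ('n, 'a) ttc_state" where
  "ttc_step prio P = (\<lambda>(N', A', \<mu>).
     let C = cycle_agents prio P N' A';
         best = (\<lambda>i. maximal (P i) (insert None (Some ` A')))
     in (N' - C, A' - {a. \<exists>i\<in>C. best i = Some a}, \<lambda>i. if i \<in> C then best i else \<mu> i))"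

text \<open>
  \<open>ttc_state prio P s\<close> is the state after \<open>s\<close> steps. The procedure stops at the first state in which
  no agents or no objects remain, so its further steps are exactly the states satisfying
  \<open>ttc_runs\<close>; later iterates of \<open>ttc_step\<close> are not part of the procedure.
\<close>

definition ttc_state :: "('a \<Rightarrow> 'n rel) \<Rightarrow> ('n, 'a) profile \<Rightarrow> nat \<Rightarrow> ('n, 'a) ttc_state" where
  "ttc_state prio P s = (ttc_step prio P ^^ s) (UNIV, UNIV, \<lambda>_. None)"

definition remaining_agents :: "('a \<Rightarrow> 'n rel) \<Rightarrow> ('n, 'a) profile \<Rightarrow> nat \<Rightarrow> 'n set" where
  "remaining_agents prio P s = fst (ttc_state prio P s)"

definition remaining_objects :: "('a \<Rightarrow> 'n rel) \<Rightarrow> ('n, 'a) profile \<Rightarrow> nat \<Rightarrow> 'a set" where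
  "remaining_objects prio P s = fst (snd (ttc_state prio P s))"

definition ttc_runs :: "('a \<Rightarrow> 'n rel) \<Rightarrow> ('n, 'a) profile \<Rightarrow> nat \<Rightarrow> bool" where
  "ttc_runs prio P s \<longleftrightarrow> remaining_agents prio P s \<noteq> {} \<and> remaining_objects prio P s \<noteq> {}"

definition fpttc :: "('a \<Rightarrow> 'n rel) \<Rightarrow> ('n, 'a) profile \<Rightarrow> ('n, 'a) assignment" where
  "fpttc prio P = snd (snd (ttc_state prio P (LEAST s. \<not> ttc_runs prio P s)))"

definition weak_serial_dictatorship :: "('a \<Rightarrow> 'n rel) \<Rightarrow> bool" where
  "weak_serial_dictatorship prio \<longleftrightarrow>
     (\<forall>P \<in> Pi UNIV (\<lambda>_. all_acceptable). \<forall>s. ttc_runs prio P s \<longrightarrow>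
        card (remaining_objects prio P s) > 2 \<longrightarrow>
        card (owner prio (remaining_agents prio P s) ` remaining_objects prio P s) = 1)"


subsection \<open>Mechanisms\<close>

text \<open>Trees are finite: otherwise a profile need not lead to a leaf.\<close>

definition rooted_tree :: "('v, 'e) pre_digraph \<Rightarrow> 'v \<Rightarrow> bool" where
  "rooted_tree T r \<longleftrightarrow> fin_digraph T \<and> r \<in> verts T \<and>
     (\<forall>v\<in>verts T. \<exists>!p. pre_digraph.awalk T r p v)"

record ('v, 'e, 'n, 'a) mechanism =
  tree :: "('v, 'e) pre_digraph"
  tree_root :: 'v
  LA :: "'v \<Rightarrow> ('n, 'a) assignment"
  NA :: "'v \<Rightarrow> 'n"
  EP :: "'e \<Rightarrow> 'a pref set"

definition leaves :: "('v, 'e, 'n, 'a) mechanism \<Rightarrow> 'v set" where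
  "leaves G = {v \<in> verts (tree G). out_arcs (tree G) v = {}}"

definition inner_nodes :: "('v, 'e, 'n, 'a) mechanism \<Rightarrow> 'v set" where
  "inner_nodes G = verts (tree G) - leaves G"

definition path_to :: "('v, 'e, 'n, 'a) mechanism \<Rightarrow> 'v \<Rightarrow> 'e list" where
  "path_to G v = (THE p. pre_digraph.awalk (tree G) (tree_root G) p v)"

text \<open>
  The \<open>t\<close>-th node of the path to \<open>v\<close> (counting from \<open>0\<close>, and excluding \<open>v\<close>) is the last one before
  \<open>v\<close> at which the agent of \<open>v\<close> is active; it is the tail of the \<open>t\<close>-th edge.
\<close>

definition last_move :: "('v, 'e, 'n, 'a) mechanism \<Rightarrow> 'v \<Rightarrow> nat \<Rightarrow> bool" where
  "last_move G v t \<longleftrightarrow>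
     (let p = path_to G v; node = (\<lambda>s. tail (tree G) (p ! s)) in
      t < length p \<and> NA G (node t) = NA G v \<and>
      (\<forall>s. t < s \<and> s < length p \<longrightarrow> NA G (node s) \<noteq> NA G v))"

text \<open>The domain is the product of the sets \<open>D i\<close>.\<close>

definition is_mechanism ::
  "('n::finite \<Rightarrow> 'a pref set) \<Rightarrow> ('v, 'e, 'n, 'a) mechanism \<Rightarrow> bool" where
  "is_mechanism D G \<longleftrightarrow>
     rooted_tree (tree G) (tree_root G) \<and>
     (\<forall>l \<in> leaves G. is_allocation (LA G l)) \<and>
     (\<forall>e \<in> arcs (tree G). EP G e \<subseteq> linear_orders \<and> EP G e \<noteq> {}) \<and>
     (\<forall>e \<in> arcs (tree G). \<forall>e' \<in> arcs (tree G).
        e \<noteq> e' \<and> tail (tree G) e = tail (tree G) e' \<longrightarrow> EP G e \<inter> EP G e' = {}) \<and>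
     (\<forall>v \<in> inner_nodes G.
        (\<forall>t. last_move G v t \<longrightarrow> (\<Union>e \<in> out_arcs (tree G) v. EP G e) = EP G (path_to G v ! t)) \<and>
        ((\<nexists>t. last_move G v t) \<longrightarrow> (\<Union>e \<in> out_arcs (tree G) v. EP G e) = D (NA G v)))"

definition passes_through ::
  "('v, 'e, 'n, 'a) mechanism \<Rightarrow> ('n, 'a) profile \<Rightarrow> 'v \<Rightarrow> bool" where
  "passes_through G P v \<longleftrightarrow> v \<in> verts (tree G) \<and>
     (\<forall>e \<in> set (path_to G v). P (NA G (tail (tree G) e)) \<in> EP G e)"

definition outcome ::
  "('v, 'e, 'n, 'a) mechanism \<Rightarrow> ('n, 'a) profile \<Rightarrow> ('n, 'a) assignment" where
  "outcome G P = LA G (THE l. l \<in> leaves G \<and> passes_through G P l)"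

definition diverge ::
  "('v, 'e, 'n, 'a) mechanism \<Rightarrow> 'v \<Rightarrow> 'a pref \<Rightarrow> 'a pref \<Rightarrow> bool" where
  "diverge G v Q Q' \<longleftrightarrow>
     (\<exists>e \<in> out_arcs (tree G) v. \<exists>e' \<in> out_arcs (tree G) v. e \<noteq> e' \<and> Q \<in> EP G e \<and> Q' \<in> EP G e')"

definition is_SOSP :: "('n \<Rightarrow> 'a pref set) \<Rightarrow> ('v, 'e, 'n, 'a) mechanism \<Rightarrow> bool" where
  "is_SOSP D G \<longleftrightarrow>
     (\<forall>i. \<forall>v \<in> inner_nodes G. NA G v = i \<longrightarrow>
        (\<forall>P \<in> Pi UNIV D. \<forall>P' \<in> Pi UNIV D. \<forall>P'' \<in> Pi UNIV D.
           passes_through G P v \<and> passes_through G P' v \<and> passes_through G P'' v \<and>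
           \<not> diverge G v (P i) (P' i) \<and> diverge G v (P i) (P'' i) \<longrightarrow>
           (outcome G P' i, outcome G P'' i) \<in> (P i)\<^sup>=))"

text \<open>Since trees are finite, taking nodes and edges to be natural numbers loses no generality.\<close>

definition SOSP_implementable ::
  "('n::finite \<Rightarrow> 'a pref set) \<Rightarrow> (('n, 'a) profile \<Rightarrow> ('n, 'a) assignment) \<Rightarrow> bool" where
  "SOSP_implementable D f \<longleftrightarrow>
     (\<exists>G :: (nat, nat, 'n, 'a) mechanism. is_mechanism D G \<and> is_SOSP D G \<and>
        (\<forall>P \<in> Pi UNIV D. f P = outcome G P))"

end

theory Submission
  imports Defs "HOL-Library.Countable"
begin

text \<open>
  If the rule is not a weak serial dictatorship, take the first step with more than two objects
  and more than one owner. At all earlier steps a single owner picks an object, so this step is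
  reached whatever the preferences of the remaining agents. Either there are three owners, or one
  agent owns two objects and another one a third object. In both cases there is a small
  subdomain on which the outcome varies, but on which no agent can be the first to reveal
  information in an SOSP mechanism.

  Conversely, under a weak serial dictatorship let the owners pick their favourites in turn as
  long as there is one owner. If two owners \<open>i\<close> and \<open>j\<close> of the last two objects remain, \<open>i\<close> either
  keeps her object or offers it, and in the latter case \<open>j\<close> accepts or declines the trade.
\<close>

section \<open>Linear orders\<close>

text \<open>Necessity has to refute every tree, not one protocol. Only one node is inspected for
  this: within a product subdomain on which the outcome varies, some agent's preferences must be
  separated at some point, so it suffices that every labelling of each agent's few preferences which
  satisfies the SOSP inequality there is constant. This needs agents who have already left to be
  frozen, so that the critical step is met at every profile of the subdomain. The third object is
  what makes it possible: it is the fallback on which a truthful agent may be thrown back while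
  another report could have brought her something better. With two objects, a ranking is a single
  bit and no such fallback exists. For sufficiency, the obstacle is that condition (b) of a
  mechanism looks back along paths of a graph. Recursive game forms in which nobody moves twice on a
  path avoid this, and their positions are coded as numbers only at the end. Since a weak serial
  dictatorship restricts only states that occur at some profile, the recursive construction carries
  a witness profile along.\<close>

lemma maximal_eqI:
  assumes "r \<in> linear_orders" "x \<in> X" "\<And>y. y \<in> X \<Longrightarrow> y \<noteq> x \<Longrightarrow> (x, y) \<in> r"
  shows "maximal r X = x"
  unfolding maximal_def
proof (rule the_equality)
  fix z assume z: "z \<in> X \<and> (\<forall>y\<in>X. y \<noteq> z \<longrightarrow> (z, y) \<in> r)"
  show "z = x"
  proof (rule ccontr)
    assume "z \<noteq> x"
    then have "(z, x) \<in> r" "(x, z) \<in> r" using z assms(2,3) by auto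
    moreover have "trans r" "irrefl r"
      using assms(1) by (auto simp: linear_orders_def strict_linear_order_on_def)
    ultimately show False by (meson irrefl_def transD)
  qed
qed (use assms in auto)

lemma linear_order_ex_maximal:
  assumes "r \<in> linear_orders" "finite X" "X \<noteq> {}"
  shows "\<exists>x\<in>X. \<forall>y\<in>X. y \<noteq> x \<longrightarrow> (x, y) \<in> r"
  using assms(2,3)
proof (induction X rule: finite_ne_induct)
  case (insert z F)
  then obtain x where x: "x \<in> F" "\<forall>y\<in>F. y \<noteq> x \<longrightarrow> (x, y) \<in> r" by auto
  have r: "trans r" "total r"
    using assms(1) by (auto simp: linear_orders_def strict_linear_order_on_def)
  have "z \<noteq> x" using insert x by auto
  then consider "(z, x) \<in> r" | "(x, z) \<in> r" using r by (auto simp: total_on_def)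
  then show ?case
  proof cases
    case 1
    then have "\<forall>y\<in>insert z F. y \<noteq> z \<longrightarrow> (z, y) \<in> r" using x r by (metis insertE transD)
    then show ?thesis by blast
  next
    case 2
    then show ?thesis using x by auto
  qed
qed auto

lemma maximal_props:
  assumes "r \<in> linear_orders" "finite X" "X \<noteq> {}"
  shows maximal_in: "maximal r X \<in> X"
    and maximal_above: "\<And>y. y \<in> X \<Longrightarrow> y \<noteq> maximal r X \<Longrightarrow> (maximal r X, y) \<in> r"
  using linear_order_ex_maximal[OF assms] maximal_eqI[OF assms(1)] by metis+

text \<open>The outside option stays among the candidates so that this is the term used by
  \<open>ttc_step\<close>; on \<open>all_acceptable\<close> and non-empty \<open>X\<close> the
  maximum is an object, so \<open>the\<close> is safe.\<close>

definition favourite :: "'a pref \<Rightarrow> 'a set \<Rightarrow> 'a" where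
  "favourite Q X = the (maximal Q (insert None (Some ` X)))"

lemma all_acceptable_linear: "Q \<in> all_acceptable \<Longrightarrow> Q \<in> linear_orders"
  by (simp add: all_acceptable_def)

lemma all_acceptable_irrefl: "Q \<in> all_acceptable \<Longrightarrow> (x, x) \<notin> Q"
  by (auto simp: all_acceptable_def linear_orders_def strict_linear_order_on_def irrefl_def)

lemma all_acceptable_asym: "Q \<in> all_acceptable \<Longrightarrow> (x, y) \<in> Q \<Longrightarrow> (y, x) \<notin> Q"
  unfolding all_acceptable_def linear_orders_def strict_linear_order_on_def irrefl_def
  by (blast dest: transD)

lemma maximal_favourite:
  fixes Q :: "'a::finite pref"
  assumes "Q \<in> all_acceptable" "X \<noteq> {}"
  shows "maximal Q (insert None (Some ` X)) = Some (favourite Q X)"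
proof -
  let ?Y = "insert None (Some ` X)"
  have "maximal Q ?Y \<noteq> None"
  proof
    assume "maximal Q ?Y = None"
    then have "(None, Some x) \<in> Q" if "x \<in> X" for x
      using maximal_above[OF all_acceptable_linear[OF assms(1)], of ?Y "Some x"] that by simp
    moreover have "(Some x, None) \<in> Q" for x using assms(1) by (simp add: all_acceptable_def)
    ultimately show False using assms all_acceptable_asym by blast
  qed
  then show ?thesis by (simp add: favourite_def)
qed

lemma favourite_props:
  fixes Q :: "'a::finite pref"
  assumes "Q \<in> all_acceptable" "X \<noteq> {}"
  shows favourite_in: "favourite Q X \<in> X"
    and favourite_above: "\<And>y. y \<in> X \<Longrightarrow> y \<noteq> favourite Q X \<Longrightarrow> (Some (favourite Q X), Some y) \<in> Q"
  using maximal_props[OF all_acceptable_linear[OF assms(1)], of "insert None (Some ` X)"]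
  by (auto simp: maximal_favourite[OF assms])

lemma favourite_eqI:
  fixes Q :: "'a::finite pref"
  assumes "Q \<in> all_acceptable" "x \<in> X" "\<And>y. y \<in> X \<Longrightarrow> y \<noteq> x \<Longrightarrow> (Some x, Some y) \<in> Q"
  shows "favourite Q X = x"
proof -
  have "X \<noteq> {}" using assms(2) by auto
  then show ?thesis
    using favourite_props[OF assms(1), of X] assms all_acceptable_asym by metis
qed

lemma maximal_objects:
  fixes Q :: "'a::finite pref"
  assumes "Q \<in> all_acceptable" "X \<noteq> {}"
  shows "maximal Q {Some a | a. a \<in> X \<and> (Some a, None) \<in> Q} = Some (favourite Q X)"
proof (rule maximal_eqI)
  show "Q \<in> linear_orders" using assms(1) by (rule all_acceptable_linear)
  show "Some (favourite Q X) \<in> {Some a | a. a \<in> X \<and> (Some a, None) \<in> Q}"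
    using favourite_in[OF assms] assms(1) by (auto simp: all_acceptable_def)
qed (use favourite_above[OF assms] in auto)

text \<open>Nested raises list the top objects from the outside in. The witness preferences of the
  impossibility proofs are built this way from a given order.\<close>

definition raise :: "'a \<Rightarrow> 'a pref \<Rightarrow> 'a pref" where
  "raise a Q = {(x, y). x \<noteq> y \<and> (x = Some a \<or> (y \<noteq> Some a \<and> (x, y) \<in> Q))}"

lemma raise_all_acceptable:
  assumes "Q \<in> all_acceptable"
  shows "raise a Q \<in> all_acceptable"
proof -
  have Q: "trans Q" "irrefl Q" "total Q" "\<And>b. (Some b, None) \<in> Q"
    using assms by (auto simp: all_acceptable_def linear_orders_def strict_linear_order_on_def)
  have "trans (raise a Q)"
  proof (rule transI)
    fix x y z assume "(x, y) \<in> raise a Q" "(y, z) \<in> raise a Q"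
    then show "(x, z) \<in> raise a Q"
      using transD[OF Q(1), of x y z] all_acceptable_asym[OF assms] by (auto simp: raise_def)
  qed
  then show ?thesis
    using Q(3,4) by (auto simp: all_acceptable_def linear_orders_def strict_linear_order_on_def
        irrefl_def total_on_def raise_def)
qed

lemma in_raise:
  "(Some x, Some y) \<in> raise a Q \<longleftrightarrow> x \<noteq> y \<and> (x = a \<or> (y \<noteq> a \<and> (Some x, Some y) \<in> Q))"
  by (auto simp: raise_def)

lemma favourite_raise:
  fixes Q :: "'a::finite pref"
  assumes "Q \<in> all_acceptable" "X \<noteq> {}"
  shows "favourite (raise a Q) X = (if a \<in> X then a else favourite Q X)"
  using assms favourite_props[OF assms]
  by (auto intro!: favourite_eqI raise_all_acceptable simp: in_raise)

lemma above_raise: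
  assumes "Q \<in> all_acceptable" "x \<noteq> Some a"
  shows "(Some a, x) \<in> raise a Q"
  using assms by (auto simp: raise_def)

section \<open>Functional graphs\<close>

text \<open>Only the successor of \<open>x\<close> has to lie in \<open>X\<close>. With
  \<open>y = x\<close> this excludes nodes from cycles: a node outside a closed set that points into
  it never returns to itself.\<close>

lemma functional_graph_closed:
  assumes "(x, y) \<in> {(i, f i) | i. i \<in> N}\<^sup>+" "f x \<in> X" "\<And>z. z \<in> X \<Longrightarrow> z \<in> N \<Longrightarrow> f z \<in> X"
  shows "y \<in> X"
  using assms(1) by (induction rule: trancl_induct) (use assms(2,3) in auto)

text \<open>A finite acyclic graph has a well-founded converse, so \<open>N\<close> would contain a
  node without successor in \<open>N\<close>.\<close>

lemma functional_graph_ex_cycle: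
  assumes "finite N" "N \<noteq> {}" "f ` N \<subseteq> N"
  shows "\<exists>x\<in>N. (x, x) \<in> {(i, f i) | i. i \<in> N}\<^sup>+"
proof (rule ccontr)
  let ?G = "{(i, f i) | i. i \<in> N}"
  assume a: "\<not> ?thesis"
  have "Domain (?G\<^sup>+) \<subseteq> N" by auto
  then have "acyclic ?G" using a unfolding acyclic_def by blast
  moreover have "finite ?G" using assms(1) by (simp add: setcompr_eq_image)
  ultimately have "wf (?G\<inverse>)" by (rule finite_acyclic_wf_converse[rotated])
  moreover obtain x where "x \<in> N" using assms(2) by auto
  ultimately obtain z where z: "z \<in> N" "\<And>y. (y, z) \<in> ?G\<inverse> \<Longrightarrow> y \<notin> N" by (rule wfE_min) blast
  then have "f z \<notin> N" by blast
  then show False using z(1) assms(3) by blast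
qed

text \<open>Every node on a cycle has a predecessor on a cycle, so \<open>f\<close> maps this finite
  set onto a superset of itself and must be injective there.\<close>

lemma functional_graph_cycles_inj:
  assumes "finite N"
  shows "inj_on f {x \<in> N. (x, x) \<in> {(i, f i) | i. i \<in> N}\<^sup>+}"
proof (rule finite_surj_inj)
  let ?G = "{(i, f i) | i. i \<in> N}"
  let ?C = "{x \<in> N. (x, x) \<in> ?G\<^sup>+}"
  show "finite ?C" using assms by simp
  show "?C \<subseteq> f ` ?C"
  proof
    fix x assume "x \<in> ?C"
    then obtain w where w: "(x, w) \<in> ?G\<^sup>*" "(w, x) \<in> ?G" by (auto dest: tranclD2)
    then have "(w, w) \<in> ?G\<^sup>+" by (rule rtrancl_into_trancl2[rotated])
    then show "x \<in> f ` ?C" using w(2) by auto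
  qed
qed

section \<open>Top trading cycles\<close>

abbreviation acc_domain :: "'n \<Rightarrow> 'a pref set" where
  "acc_domain \<equiv> \<lambda>_. all_acceptable"

definition stopped :: "('n, 'a) ttc_state \<Rightarrow> bool" where
  "stopped S \<longleftrightarrow> fst S = {} \<or> fst (snd S) = {}"

text \<open>Starting from an arbitrary state allows both directions to reason about the rest of a
  run.\<close>

definition ttc_result :: "('a \<Rightarrow> 'n rel) \<Rightarrow> ('n, 'a) profile \<Rightarrow> ('n, 'a) ttc_state \<Rightarrow> ('n, 'a) assignment" where
  "ttc_result prio P S = snd (snd ((ttc_step prio P ^^ (LEAST s. stopped ((ttc_step prio P ^^ s) S))) S))"

lemma ttc_runs_iff: "ttc_runs prio P s \<longleftrightarrow> \<not> stopped (ttc_state prio P s)"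
  by (simp add: ttc_runs_def stopped_def remaining_agents_def remaining_objects_def)

lemma fpttc_eq_result: "fpttc prio P = ttc_result prio P (UNIV, UNIV, \<lambda>_. None)"
  by (simp add: fpttc_def ttc_result_def ttc_runs_iff ttc_state_def)

lemma ttc_state_0: "ttc_state prio P 0 = (UNIV, UNIV, \<lambda>_. None)"
  by (simp add: ttc_state_def)

lemma ttc_state_Suc: "ttc_state prio P (Suc s) = ttc_step prio P (ttc_state prio P s)"
  by (simp add: ttc_state_def)

lemma result_stopped: "stopped S \<Longrightarrow> ttc_result prio P S = snd (snd S)"
  by (simp add: ttc_result_def Least_eq_0)

text \<open>The invariant that makes the final assignment an allocation: objects already handed out
  are no longer available to later recipients.\<close>

definition valid_state :: "('n, 'a) ttc_state \<Rightarrow> bool" where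
  "valid_state = (\<lambda>(N', A', \<mu>). (\<forall>i\<in>N'. \<mu> i = None) \<and> (\<forall>i a. \<mu> i = Some a \<longrightarrow> a \<notin> A') \<and>
     (\<forall>i j a. \<mu> i = Some a \<longrightarrow> \<mu> j = Some a \<longrightarrow> i = j))"

lemma is_allocation_iff:
  "is_allocation \<mu> \<longleftrightarrow> (\<forall>i j a. \<mu> i = Some a \<longrightarrow> \<mu> j = Some a \<longrightarrow> i = j)"
proof -
  have "card (\<mu> -` {Some a}) \<le> 1 \<longleftrightarrow> (\<forall>i j. \<mu> i = Some a \<longrightarrow> \<mu> j = Some a \<longrightarrow> i = j)" for a
    using card_le_Suc0_iff_eq[of "\<mu> -` {Some a}"] by auto
  then show ?thesis unfolding is_allocation_def by blast
qed

section \<open>Cycles in a single step of the procedure\<close>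

locale priorities =
  fixes prio :: "'a::finite \<Rightarrow> 'n::finite rel"
  assumes prio: "priority_structure prio"
begin

definition pointee :: "('n, 'a) profile \<Rightarrow> 'n set \<Rightarrow> 'a set \<Rightarrow> 'n \<Rightarrow> 'n" where
  "pointee P N' A' i = owner prio N' (favourite (P i) A')"

lemma owner_in: "N' \<noteq> {} \<Longrightarrow> owner prio N' a \<in> N'"
  using prio unfolding owner_def priority_structure_def by (simp add: maximal_in)

lemma owner_subset:
  assumes "owner prio N' a \<in> N''" "N'' \<subseteq> N'"
  shows "owner prio N'' a = owner prio N' a"
proof -
  have "N' \<noteq> {}" using assms by auto
  then show ?thesis
    using prio assms unfolding owner_def priority_structure_def
    by (intro maximal_eqI) (auto intro!: maximal_above)
qed

lemma pointee_in: "N' \<noteq> {} \<Longrightarrow> pointee P N' A' i \<in> N'"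
  by (simp add: pointee_def owner_in)

context
  fixes P :: "('n, 'a) profile"
  assumes P: "P \<in> Pi UNIV acc_domain"
begin

lemma P_acceptable: "P i \<in> all_acceptable"
  using P by auto

lemma cycle_agents_eq:
  assumes "A' \<noteq> {}"
  shows "cycle_agents prio P N' A' = {i \<in> N'. (i, i) \<in> {(i, pointee P N' A' i) | i. i \<in> N'}\<^sup>+}"
proof -
  have "points_to prio P N' A' i = pointee P N' A' i" for i
    using assms P_acceptable[of i] maximal_objects[OF P_acceptable[of i] assms]
    by (auto simp: points_to_def pointee_def all_acceptable_def)
  then show ?thesis by (simp add: cycle_agents_def pointing_graph_def)
qed

lemma cycle_agents_closed:
  assumes "A' \<noteq> {}" "i \<in> cycle_agents prio P N' A'"
    "pointee P N' A' i \<in> X" "\<And>j. j \<in> X \<Longrightarrow> j \<in> N' \<Longrightarrow> pointee P N' A' j \<in> X"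
  shows "i \<in> X"
  using functional_graph_closed[of i i "pointee P N' A'" N' X] assms by (simp add: cycle_agents_eq)

lemma self_cycle:
  assumes "A' \<noteq> {}" "i \<in> N'" "pointee P N' A' i = i"
  shows "i \<in> cycle_agents prio P N' A'"
  using assms by (force simp: cycle_agents_eq intro: r_into_trancl)

lemma two_cycle:
  assumes "A' \<noteq> {}" "i \<in> N'" "j \<in> N'" "pointee P N' A' i = j" "pointee P N' A' j = i"
  shows "i \<in> cycle_agents prio P N' A'"
proof -
  have "(i, j) \<in> {(i, pointee P N' A' i) | i. i \<in> N'}" "(j, i) \<in> {(i, pointee P N' A' i) | i. i \<in> N'}"
    using assms by auto
  then have "(i, i) \<in> {(i, pointee P N' A' i) | i. i \<in> N'}\<^sup>+" by (meson trancl.simps)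
  then show ?thesis using assms by (simp add: cycle_agents_eq)
qed

lemma cycle_agents_inj: "A' \<noteq> {} \<Longrightarrow> inj_on (pointee P N' A') (cycle_agents prio P N' A')"
  by (simp add: cycle_agents_eq functional_graph_cycles_inj)

lemma cycle_agents_nonempty: "A' \<noteq> {} \<Longrightarrow> N' \<noteq> {} \<Longrightarrow> cycle_agents prio P N' A' \<noteq> {}"
  using functional_graph_ex_cycle[of N' "pointee P N' A'"] pointee_in[of N' P A']
  by (auto simp: cycle_agents_eq image_subset_iff)

lemma cycle_agents_subset: "cycle_agents prio P N' A' \<subseteq> N'"
  by (auto simp: cycle_agents_def)

lemma ttc_step_eq:
  assumes "A' \<noteq> {}"
  shows "ttc_step prio P (N', A', \<mu>) = (let C = cycle_agents prio P N' A' in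
     (N' - C, A' - (\<lambda>i. favourite (P i) A') ` C, \<lambda>i. if i \<in> C then Some (favourite (P i) A') else \<mu> i))"
  using maximal_favourite[OF P_acceptable assms] by (auto simp: ttc_step_def Let_def)

lemma sole_cycle_step:
  assumes "A' \<noteq> {}" "cycle_agents prio P N' A' = {d}"
  shows "ttc_step prio P (N', A', \<mu>) =
     (N' - {d}, A' - {favourite (P d) A'}, \<mu>(d := Some (favourite (P d) A')))"
  using assms by (auto simp: ttc_step_eq)

text \<open>The set \<open>{d}\<close> is closed under pointing and everyone points into it, so no
  other agent is in a cycle; some cycle exists, hence it is the self-loop at
  \<open>d\<close>.\<close>

lemma common_pointee_cycle:
  assumes "N' \<noteq> {}" "A' \<noteq> {}" "\<And>i. i \<in> N' \<Longrightarrow> pointee P N' A' i = d"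
  shows "cycle_agents prio P N' A' = {d}"
proof -
  have "cycle_agents prio P N' A' \<subseteq> {d}"
    using cycle_agents_closed[of A' _ N' "{d}"] cycle_agents_subset assms by blast
  then show ?thesis using cycle_agents_nonempty[of A' N'] assms by blast
qed

lemma sole_owner_cycle:
  assumes "N' \<noteq> {}" "A' \<noteq> {}" "owner prio N' ` A' = {d}"
  shows "cycle_agents prio P N' A' = {d}"
  using assms favourite_in[OF P_acceptable assms(2)]
  by (intro common_pointee_cycle) (auto simp: pointee_def)

section \<open>Complete runs and their invariants\<close>

lemma step_decreasing:
  "fst (ttc_step prio P S) \<subseteq> fst S" "fst (snd (ttc_step prio P S)) \<subseteq> fst (snd S)"
  by (auto simp: ttc_step_def Let_def split: prod.split)

text \<open>Each step before stopping has a cycle and so removes an agent.\<close>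

lemma ex_stopped: "\<exists>s. stopped ((ttc_step prio P ^^ s) S)"
proof (induction "card (fst S)" arbitrary: S rule: less_induct)
  case less
  show ?case
  proof (cases "stopped S")
    case True
    then have "stopped ((ttc_step prio P ^^ 0) S)" by simp
    then show ?thesis by blast
  next
    case False
    obtain N' A' \<mu> where S: "S = (N', A', \<mu>)" by (cases S)
    have "fst (ttc_step prio P S) \<subset> fst S"
      using False cycle_agents_nonempty[of A' N'] cycle_agents_subset[of N' A']
      by (auto simp: S stopped_def ttc_step_eq Let_def)
    then have "card (fst (ttc_step prio P S)) < card (fst S)" by (simp add: psubset_card_mono)
    from less[OF this] obtain s where "stopped ((ttc_step prio P ^^ s) (ttc_step prio P S))" ..
    then have "stopped ((ttc_step prio P ^^ Suc s) S)" by (simp add: funpow_swap1)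
    then show ?thesis by blast
  qed
qed

lemma result_step:
  assumes "\<not> stopped S"
  shows "ttc_result prio P S = ttc_result prio P (ttc_step prio P S)"
proof -
  obtain s where s: "stopped ((ttc_step prio P ^^ s) S)" using ex_stopped by blast
  have "(LEAST s. stopped ((ttc_step prio P ^^ s) S)) =
      Suc (LEAST s. stopped ((ttc_step prio P ^^ Suc s) S))"
    by (rule Least_Suc[where P = "\<lambda>s. stopped ((ttc_step prio P ^^ s) S)", OF s]) (use assms in simp)
  then show ?thesis by (simp add: ttc_result_def funpow_swap1)
qed

lemma ttc_runs_mono: "ttc_runs prio P s \<Longrightarrow> t \<le> s \<Longrightarrow> ttc_runs prio P t"
proof (induction s)
  case (Suc s)
  have "ttc_runs prio P s"
    using Suc.prems(1) step_decreasing[of "ttc_state prio P s"]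
    by (auto simp: ttc_runs_iff ttc_state_Suc stopped_def)
  then show ?case using Suc by (metis le_Suc_eq)
qed auto

lemma remaining_objects_antimono:
  "t \<le> s \<Longrightarrow> remaining_objects prio P s \<subseteq> remaining_objects prio P t"
proof (induction rule: dec_induct)
  case (step k)
  then show ?case using step_decreasing(2)[of "ttc_state prio P k"] by (auto simp: remaining_objects_def ttc_state_Suc)
qed simp

lemma remaining_agents_antimono:
  "t \<le> s \<Longrightarrow> remaining_agents prio P s \<subseteq> remaining_agents prio P t"
proof (induction rule: dec_induct)
  case (step k)
  then show ?case using step_decreasing(1)[of "ttc_state prio P k"] by (auto simp: remaining_agents_def ttc_state_Suc)
qed simp

lemma fpttc_eq_result_state:
  "ttc_runs prio P s \<Longrightarrow> fpttc prio P = ttc_result prio P (ttc_state prio P s)"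
proof (induction s)
  case (Suc s)
  then have "ttc_runs prio P s" using ttc_runs_mono by (metis le_SucI order_refl)
  then show ?case using Suc.IH result_step by (simp add: ttc_runs_iff ttc_state_Suc)
qed (simp add: fpttc_eq_result ttc_state_0)

text \<open>The conclusion keeps the whole stopped state and not only its assignment, because
  invariants also speak about the remaining agents and objects.\<close>

lemma result_induct:
  assumes "R S" "\<And>S. R S \<Longrightarrow> \<not> stopped S \<Longrightarrow> R (ttc_step prio P S)"
  shows "\<exists>S'. stopped S' \<and> R S' \<and> ttc_result prio P S = snd (snd S')"
proof -
  obtain s where "stopped ((ttc_step prio P ^^ s) S)" using ex_stopped by blast
  then show ?thesis using assms(1)
  proof (induction s arbitrary: S)
    case 0
    then show ?case using result_stopped by fastforce
  next
    case (Suc s)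
    show ?case
    proof (cases "stopped S")
      case True
      then show ?thesis using Suc.prems result_stopped by blast
    next
      case False
      have "stopped ((ttc_step prio P ^^ s) (ttc_step prio P S))"
        using Suc.prems(1) by (simp add: funpow_swap1)
      then show ?thesis using Suc.IH assms(2) False Suc.prems(2) result_step by metis
    qed
  qed
qed

text \<open>A step overwrites only the entries of agents in cycles, and these are among the
  remaining agents.\<close>

lemma result_removed:
  assumes "i \<notin> N'"
  shows "ttc_result prio P (N', A', \<mu>) i = \<mu> i"
proof -
  have "\<exists>S'. stopped S' \<and> (i \<notin> fst S' \<and> snd (snd S') i = \<mu> i) \<and>
      ttc_result prio P (N', A', \<mu>) = snd (snd S')"
  proof (rule result_induct)
    fix S :: "('n, 'a) ttc_state"
    obtain N' A' \<nu> where S: "S = (N', A', \<nu>)" by (cases S)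
    assume "i \<notin> fst S \<and> snd (snd S) i = \<mu> i" "\<not> stopped S"
    then show "i \<notin> fst (ttc_step prio P S) \<and> snd (snd (ttc_step prio P S)) i = \<mu> i"
      using cycle_agents_subset[of N' A'] by (auto simp: S stopped_def ttc_step_eq Let_def)
  qed (use assms in simp)
  then show ?thesis by metis
qed

lemma result_cycle:
  assumes "A' \<noteq> {}" "i \<in> cycle_agents prio P N' A'"
  shows "ttc_result prio P (N', A', \<mu>) i = Some (favourite (P i) A')"
proof -
  have "i \<in> N'" using assms(2) cycle_agents_subset by auto
  then have "ttc_result prio P (N', A', \<mu>) = ttc_result prio P (ttc_step prio P (N', A', \<mu>))"
    using assms by (intro result_step) (auto simp: stopped_def)
  then show ?thesis using assms by (simp add: ttc_step_eq Let_def result_removed)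
qed

text \<open>Two agents in cycles with the same favourite would point to the same owner, which
  injectivity of pointing on cycles forbids.\<close>

lemma valid_step:
  assumes "valid_state S" "\<not> stopped S"
  shows "valid_state (ttc_step prio P S)"
proof -
  obtain N' A' \<mu> where S: "S = (N', A', \<mu>)" by (cases S)
  have A': "A' \<noteq> {}" using assms by (simp add: S stopped_def)
  let ?C = "cycle_agents prio P N' A'"
  have inj: "i = j" if "i \<in> ?C" "j \<in> ?C" "favourite (P i) A' = favourite (P j) A'" for i j
    using inj_onD[OF cycle_agents_inj[OF A']] that by (simp add: pointee_def)
  have "favourite (P i) A' \<in> A'" for i using favourite_in P_acceptable A' by blast
  then show ?thesis
    using assms(1) inj cycle_agents_subset[of N' A'] unfolding S valid_state_def
    by (auto simp: ttc_step_eq[OF A'] Let_def split: if_splits) metis+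
qed

lemma fpttc_inj:
  assumes "fpttc prio P i = Some a" "fpttc prio P j = Some a"
  shows "i = j"
proof -
  have "\<exists>S'. stopped S' \<and> valid_state S' \<and> ttc_result prio P (UNIV, UNIV, \<lambda>_. None) = snd (snd S')"
    by (rule result_induct[where R = valid_state, OF _ valid_step]) (auto simp: valid_state_def)
  then show ?thesis using assms by (auto simp: fpttc_eq_result valid_state_def)
qed

end

end

section \<open>Passing through the nodes of a mechanism\<close>

locale mechanism_on =
  fixes D :: "'n::finite \<Rightarrow> 'a pref set" and G :: "('v, 'e, 'n, 'a) mechanism"
  assumes mechanism: "is_mechanism D G"
begin

sublocale fin_digraph "tree G"
  using mechanism by (simp add: is_mechanism_def rooted_tree_def)

lemma ex1_walk: "v \<in> verts (tree G) \<Longrightarrow> \<exists>!p. awalk (tree_root G) p v"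
  using mechanism by (simp add: is_mechanism_def rooted_tree_def)

lemma root_in: "tree_root G \<in> verts (tree G)"
  using mechanism by (simp add: is_mechanism_def rooted_tree_def)

lemma path_to_walk: "v \<in> verts (tree G) \<Longrightarrow> awalk (tree_root G) (path_to G v) v"
  unfolding path_to_def by (rule theI') (rule ex1_walk)

lemma path_to_eqI: "awalk (tree_root G) p v \<Longrightarrow> path_to G v = p"
  using ex1_walk path_to_walk awalk_last_in_verts by blast

lemma path_to_root: "path_to G (tree_root G) = []"
  by (rule path_to_eqI) (simp add: awalk_Nil_iff root_in)

lemma path_to_head:
  assumes "e \<in> arcs (tree G)"
  shows "path_to G (head (tree G) e) = path_to G (tail (tree G) e) @ [e]"
proof (rule path_to_eqI)
  have "awalk (tree_root G) (path_to G (tail (tree G) e)) (tail (tree G) e)"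
    using assms by (simp add: path_to_walk)
  then show "awalk (tree_root G) (path_to G (tail (tree G) e) @ [e]) (head (tree G) e)"
    using assms by (auto simp: awalk_Cons_iff awalk_Nil_iff)
qed

lemma passes_through_head:
  assumes "e \<in> arcs (tree G)"
  shows "passes_through G P (head (tree G) e) \<longleftrightarrow>
    passes_through G P (tail (tree G) e) \<and> P (NA G (tail (tree G) e)) \<in> EP G e"
  using assms by (auto simp: passes_through_def path_to_head)

lemma passes_through_root: "passes_through G P (tree_root G)"
  by (simp add: passes_through_def path_to_root root_in)

lemma EP_disjoint:
  assumes "e \<in> arcs (tree G)" "e' \<in> arcs (tree G)" "tail (tree G) e = tail (tree G) e'"
    "Q \<in> EP G e" "Q \<in> EP G e'"
  shows "e = e'"
proof (rule ccontr)
  assume "e \<noteq> e'"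
  then have "EP G e \<inter> EP G e' = {}" using mechanism assms(1-3) unfolding is_mechanism_def by blast
  then show False using assms(4,5) by blast
qed

text \<open>Existence is condition (b): the arcs at \<open>v\<close> cover the arc taken at the
  active agent's last move, which \<open>P\<close> has followed, or her whole domain if she has not
  moved. Uniqueness is condition (a).\<close>

lemma passes_through_arc:
  assumes "P \<in> Pi UNIV D" "v \<in> inner_nodes G" "passes_through G P v"
  shows "\<exists>!e. e \<in> out_arcs (tree G) v \<and> P (NA G v) \<in> EP G e"
proof (rule ex_ex1I)
  have "P (NA G v) \<in> (\<Union>e \<in> out_arcs (tree G) v. EP G e)"
  proof (cases "\<exists>t. last_move G v t")
    case True
    then obtain t where t: "last_move G v t" ..
    then have "P (NA G v) \<in> EP G (path_to G v ! t)"
      using assms(3) nth_mem[of t "path_to G v"]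
      by (metis last_move_def passes_through_def)
    then show ?thesis using mechanism assms(2) t unfolding is_mechanism_def by blast
  next
    case False
    then show ?thesis using mechanism assms unfolding is_mechanism_def by fastforce
  qed
  then show "\<exists>e. e \<in> out_arcs (tree G) v \<and> P (NA G v) \<in> EP G e" by blast
  fix e e' assume "e \<in> out_arcs (tree G) v \<and> P (NA G v) \<in> EP G e"
    "e' \<in> out_arcs (tree G) v \<and> P (NA G v) \<in> EP G e'"
  then show "e = e'" by (auto intro: EP_disjoint)
qed

text \<open>One profile cannot follow two arcs out of the same node, so two walks that it follows
  from \<open>u\<close> never branch.\<close>

lemma walks_comparable:
  assumes "awalk u p v" "awalk u q w" "\<forall>e\<in>set p \<union> set q. P (NA G (tail (tree G) e)) \<in> EP G e"
  shows "(\<exists>r. q = p @ r) \<or> (\<exists>r. p = q @ r)"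
  using assms
proof (induction p arbitrary: u q)
  case (Cons e p)
  show ?case
  proof (cases q)
    case (Cons e' q')
    have "e = e'"
      using Cons.prems by (auto simp: Cons awalk_Cons_iff intro: EP_disjoint)
    then show ?thesis using Cons.IH[of "head (tree G) e" q'] Cons.prems by (auto simp: Cons awalk_Cons_iff)
  qed simp
qed simp

text \<open>The root paths of two leaves on the way of \<open>P\<close> are comparable, and a leaf
  has no outgoing arc, so they coincide. Thus the description in \<open>outcome\<close> denotes the
  leaf reached.\<close>

lemma outcome_leaf:
  assumes "l \<in> leaves G" "passes_through G P l"
  shows "outcome G P = LA G l"
proof -
  have *: "q = p" if "v \<in> leaves G" "awalk (tree_root G) p v" "awalk (tree_root G) q w" "q = p @ r"
    for v w p q r
    using that by (cases r) (auto simp: leaves_def awalk_Cons_iff out_arcs_def)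
  have "l' = l" if l': "l' \<in> leaves G" "passes_through G P l'" for l'
  proof -
    have walks: "awalk (tree_root G) (path_to G l) l" "awalk (tree_root G) (path_to G l') l'"
      using l' assms by (auto intro: path_to_walk simp: leaves_def)
    have "(\<exists>r. path_to G l' = path_to G l @ r) \<or> (\<exists>r. path_to G l = path_to G l' @ r)"
      using walks_comparable[OF walks, of P] l' assms unfolding passes_through_def by blast
    then have "path_to G l' = path_to G l"
      using *[OF assms(1) walks] *[OF l'(1) walks(2,1)] by metis
    then show ?thesis using walks by (metis awlast_if_cas awalk_def)
  qed
  then show ?thesis using assms unfolding outcome_def by (metis (mono_tags, lifting) the_equality)
qed

end

text \<open>The SOSP inequality at one node where \<open>i\<close> moves. The arc taken is
  abstracted to a label \<open>c\<close>, and the rest of the tree is visible only through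
  \<open>f\<close>.\<close>

definition obvious_split ::
  "(('n, 'a) profile \<Rightarrow> ('n, 'a) assignment) \<Rightarrow> ('n \<Rightarrow> 'a pref set) \<Rightarrow> 'n \<Rightarrow> ('a pref \<Rightarrow> 'c) \<Rightarrow> bool" where
  "obvious_split f D' i c \<longleftrightarrow>
     (\<forall>P \<in> Pi UNIV D'. \<forall>P' \<in> Pi UNIV D'. \<forall>P'' \<in> Pi UNIV D'.
        c (P i) = c (P' i) \<and> c (P i) \<noteq> c (P'' i) \<longrightarrow> (f P' i, f P'' i) \<in> (P i)\<^sup>=)"

text \<open>
  The split occurs at the last node through which all profiles in the subdomain \<open>D'\<close> pass; \<open>c\<close>
  maps a preference of the agent active there to its edge.
\<close>

lemma SOSP_first_divergence:
  fixes G :: "('v, 'e, 'n::finite, 'a) mechanism"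
  assumes G: "is_mechanism D G" "is_SOSP D G" "\<forall>P\<in>Pi UNIV D. f P = outcome G P"
    and D': "\<And>i. D' i \<subseteq> D i"
    and P1: "P1 \<in> Pi UNIV D'" and P2: "P2 \<in> Pi UNIV D'" and ne: "f P1 \<noteq> f P2"
  obtains i and c :: "'a pref \<Rightarrow> 'e" where "\<exists>Q\<in>D' i. \<exists>Q'\<in>D' i. c Q \<noteq> c Q'"
    "obvious_split f D' i c"
proof -
  interpret mechanism_on D G by unfold_locales (rule G(1))
  let ?V = "{v \<in> verts (tree G). \<forall>P\<in>Pi UNIV D'. passes_through G P v}"
  have sub: "P \<in> Pi UNIV D" if "P \<in> Pi UNIV D'" for P using that D' by blast
  have "finite ?V" "?V \<noteq> {}" using root_in passes_through_root by auto
  then obtain v where v: "v \<in> ?V" "\<And>w. w \<in> ?V \<Longrightarrow> length (path_to G w) \<le> length (path_to G v)"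
    using Max_in[of "(\<lambda>v. length (path_to G v)) ` ?V"] Max_ge[of "(\<lambda>v. length (path_to G v)) ` ?V"]
    by (smt (verit) finite_imageI imageE imageI image_is_empty)
  have passes: "passes_through G P v" if "P \<in> Pi UNIV D'" for P using v(1) that by blast
  have "v \<notin> leaves G"
  proof
    assume "v \<in> leaves G"
    then have "f P = LA G v" if "P \<in> Pi UNIV D'" for P
      using that passes outcome_leaf G(3) sub by metis
    then show False using ne P1 P2 by simp
  qed
  then have inner: "v \<in> inner_nodes G" using v(1) by (simp add: inner_nodes_def)
  define i where "i = NA G v"
  define c where "c Q = (THE e. e \<in> out_arcs (tree G) v \<and> Q \<in> EP G e)" for Q
  have c: "c Q \<in> out_arcs (tree G) v \<and> Q \<in> EP G (c Q)"
    and c_unique: "e \<in> out_arcs (tree G) v \<Longrightarrow> Q \<in> EP G e \<Longrightarrow> e = c Q" if "Q \<in> D' i" for Q e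
  proof -
    \<comment> \<open>The subdomain is a product, so every preference in \<open>D' i\<close> extends
      to a profile that passes through \<open>v\<close>.\<close>
    have "P1(i := Q) \<in> Pi UNIV D'" using P1 that by auto
    then have "\<exists>!e. e \<in> out_arcs (tree G) v \<and> Q \<in> EP G e"
      using passes_through_arc[of "P1(i := Q)" v] inner passes sub by (simp add: i_def)
    then show "c Q \<in> out_arcs (tree G) v \<and> Q \<in> EP G (c Q)"
      "e \<in> out_arcs (tree G) v \<Longrightarrow> Q \<in> EP G e \<Longrightarrow> e = c Q"
      unfolding c_def by (metis (mono_tags, lifting) theI, metis (mono_tags, lifting) the_equality)
  qed
  have diverge: "diverge G v Q Q' \<longleftrightarrow> c Q \<noteq> c Q'" if "Q \<in> D' i" "Q' \<in> D' i" for Q Q'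
    using c[OF that(1)] c[OF that(2)] c_unique[OF that(1)] c_unique[OF that(2)]
    unfolding diverge_def by metis
  have "\<exists>Q\<in>D' i. \<exists>Q'\<in>D' i. c Q \<noteq> c Q'"
  proof (rule ccontr)
    assume const: "\<not> ?thesis"
    \<comment> \<open>If all preferences of \<open>i\<close> take the same arc, so do all profiles,
      and the head of this arc is a deeper common node.\<close>
    let ?e = "c (P1 i)"
    have e: "?e \<in> arcs (tree G)" "tail (tree G) ?e = v" using c[of "P1 i"] P1 by auto
    have "passes_through G P (head (tree G) ?e)" if "P \<in> Pi UNIV D'" for P
    proof -
      have "P i \<in> D' i" "P1 i \<in> D' i" using that P1 by auto
      then have "P i \<in> EP G ?e" using const c by metis
      then show ?thesis using passes[OF that] e by (simp add: passes_through_head i_def)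
    qed
    then have "head (tree G) ?e \<in> ?V" using e by auto
    then show False using v(2) e by (fastforce simp: path_to_head)
  qed
  moreover have "(f P' i, f P'' i) \<in> (P i)\<^sup>="
    if P: "P \<in> Pi UNIV D'" "P' \<in> Pi UNIV D'" "P'' \<in> Pi UNIV D'"
      and ceq: "c (P i) = c (P' i)" "c (P i) \<noteq> c (P'' i)" for P P' P''
  proof -
    have "P i \<in> D' i" "P' i \<in> D' i" "P'' i \<in> D' i" using P by auto
    then have "\<not> diverge G v (P i) (P' i)" "diverge G v (P i) (P'' i)" using ceq diverge by auto
    then have "(outcome G P' i, outcome G P'' i) \<in> (P i)\<^sup>="
      using G(2) inner passes P sub unfolding is_SOSP_def i_def by blast
    then show ?thesis using P sub G(3) by metis
  qed
  ultimately show ?thesis using that unfolding obvious_split_def by blast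
qed

section \<open>Mechanisms from game forms\<close>

text \<open>
  At \<open>Node i c t\<close> agent \<open>i\<close> reveals the value \<open>c Q\<close> of her preference \<open>Q\<close>, and the game continues
  with \<open>t (c Q)\<close>.
\<close>

datatype ('n, 'a, 'k) game =
  Leaf "('n, 'a) assignment"
| Node 'n "'a pref \<Rightarrow> 'k" "'k \<Rightarrow> ('n, 'a, 'k) game"

primrec play :: "('n, 'a, 'k) game \<Rightarrow> ('n, 'a) profile \<Rightarrow> ('n, 'a) assignment" where
  "play (Leaf \<mu>) = (\<lambda>P. \<mu>)"
| "play (Node i c t) = (\<lambda>P. play (t (c (P i))) P)"

text \<open>Only labels revealed by some admissible preference count, which keeps the tree finite
  for finite domains and every arc's preference set non-empty.\<close>

fun is_position :: "('n \<Rightarrow> 'a pref set) \<Rightarrow> ('n, 'a, 'k) game \<Rightarrow> 'k list \<Rightarrow> bool" where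
  "is_position D g [] \<longleftrightarrow> True"
| "is_position D (Leaf \<mu>) (k # w) \<longleftrightarrow> False"
| "is_position D (Node i c t) (k # w) \<longleftrightarrow> k \<in> c ` D i \<and> is_position D (t k) w"

fun subgame :: "('n, 'a, 'k) game \<Rightarrow> 'k list \<Rightarrow> ('n, 'a, 'k) game" where
  "subgame g [] = g"
| "subgame (Leaf \<mu>) (k # w) = Leaf \<mu>"
| "subgame (Node i c t) (k # w) = subgame (t k) w"

fun leaf_assignment :: "('n, 'a, 'k) game \<Rightarrow> ('n, 'a) assignment" where
  "leaf_assignment (Leaf \<mu>) = \<mu>"
| "leaf_assignment (Node i c t) = (\<lambda>_. None)"

fun mover :: "('n, 'a, 'k) game \<Rightarrow> 'n" where
  "mover (Leaf \<mu>) = undefined"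
| "mover (Node i c t) = i"

fun choices :: "('n \<Rightarrow> 'a pref set) \<Rightarrow> ('n, 'a, 'k) game \<Rightarrow> 'k \<Rightarrow> 'a pref set" where
  "choices D (Leaf \<mu>) k = {}"
| "choices D (Node i c t) k = {Q \<in> D i. c Q = k}"

text \<open>Membership in \<open>D i\<close> is part of the test because the preference sets on arcs
  lie in the domain; the agreement with \<open>passes_through\<close> then holds for arbitrary
  \<open>P\<close>.\<close>

fun follows :: "('n \<Rightarrow> 'a pref set) \<Rightarrow> ('n, 'a, 'k) game \<Rightarrow> ('n, 'a) profile \<Rightarrow> 'k list \<Rightarrow> bool" where
  "follows D g P [] \<longleftrightarrow> True"
| "follows D (Leaf \<mu>) P (k # w) \<longleftrightarrow> False"
| "follows D (Node i c t) P (k # w) \<longleftrightarrow> P i \<in> D i \<and> c (P i) = k \<and> follows D (t k) P w"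

primrec movers :: "('n \<Rightarrow> 'a pref set) \<Rightarrow> ('n, 'a, 'k) game \<Rightarrow> 'n set" where
  "movers D (Leaf \<mu>) = {}"
| "movers D (Node i c t) = insert i (\<Union>k\<in>c ` D i. movers D (t k))"

text \<open>
  No agent moves twice on a path, so that condition (b) on mechanisms never refers to an earlier
  move.
\<close>

primrec obvious_game :: "('n::finite \<Rightarrow> 'a pref set) \<Rightarrow> ('n, 'a, 'k) game \<Rightarrow> bool" where
  "obvious_game D (Leaf \<mu>) \<longleftrightarrow> is_allocation \<mu>"
| "obvious_game D (Node i c t) \<longleftrightarrow>
     (\<forall>k\<in>c ` D i. i \<notin> movers D (t k) \<and> obvious_game D (t k)) \<and>
     (\<forall>P \<in> Pi UNIV D. \<forall>P' \<in> Pi UNIV D. \<forall>P'' \<in> Pi UNIV D.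
        c (P i) = c (P' i) \<and> c (P i) \<noteq> c (P'' i) \<longrightarrow>
        (play (t (c (P' i))) P' i, play (t (c (P'' i))) P'' i) \<in> (P i)\<^sup>=)"

lemma finite_positions:
  assumes "\<And>i. finite (D i)"
  shows "finite {w. is_position D g w}"
proof (induction g)
  case (Leaf \<mu>)
  have "w = []" if "is_position D (Leaf \<mu>) w" for w :: "'c list" using that by (cases w) auto
  then have "{w :: 'c list. is_position D (Leaf \<mu>) w} \<subseteq> {[]}" by blast
  then show ?case by (rule finite_subset) simp
next
  case (Node i c t)
  have "w \<in> insert [] (\<Union>k\<in>c ` D i. (#) k ` {w. is_position D (t k) w})"
    if "is_position D (Node i c t) w" for w
    using that by (cases w) auto
  moreover have "finite (insert [] (\<Union>k\<in>c ` D i. (#) k ` {w. is_position D (t k) w}))"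
    using Node assms by simp
  ultimately show ?case by (metis (mono_tags, lifting) finite_subset mem_Collect_eq subsetI)
qed

text \<open>Games recurse on the first move of a position, whereas an arc of the tree appends a last
  one; this lemma and the next translate between the two.\<close>

lemma is_position_snoc:
  "is_position D g (w @ [k]) \<longleftrightarrow> is_position D g w \<and> choices D (subgame g w) k \<noteq> {}"
  by (induction D g w rule: is_position.induct) (auto split: game.splits, (case_tac g; auto)+)

lemma follows_snoc:
  "follows D g P (w @ [k]) \<longleftrightarrow> follows D g P w \<and> P (mover (subgame g w)) \<in> choices D (subgame g w) k"
  by (induction D g P w rule: follows.induct) (auto split: game.splits, (case_tac g; auto)+)

lemma follows_position: "follows D g P w \<Longrightarrow> is_position D g w"
  by (induction D g P w rule: follows.induct) auto

lemma play_subgame: "follows D g P w \<Longrightarrow> play g P = play (subgame g w) P"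
  by (induction D g P w rule: follows.induct) auto

lemma obvious_subgame: "is_position D g w \<Longrightarrow> obvious_game D g \<Longrightarrow> obvious_game D (subgame g w)"
  by (induction D g w rule: is_position.induct) auto

lemma mover_subgame:
  "is_position D g w \<Longrightarrow> subgame g w = Node i c t \<Longrightarrow> i \<in> movers D g"
  by (induction D g w rule: is_position.induct) auto

text \<open>An agent who moves at \<open>w\<close> is excluded from the movers of every
  continuation, and the agent of any later position is one of these.\<close>

lemma movers_distinct:
  "is_position D g (w @ k # w') \<Longrightarrow> obvious_game D g \<Longrightarrow> subgame g (w @ k # w') = Node i c t \<Longrightarrow>
    mover (subgame g w) \<noteq> i"
proof (induction D g w rule: is_position.induct)
  case (1 D g)
  then show ?case by (cases g) (auto dest: mover_subgame)
qed auto

lemma ex_leaf_position: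
  assumes "P \<in> Pi UNIV D"
  shows "\<exists>w. follows D g P w \<and> subgame g w = Leaf (play g P)"
proof (induction g)
  case (Leaf \<mu>)
  show ?case by (rule exI[of _ "[]"]) simp
next
  case (Node i c t)
  then obtain w where "follows D (t (c (P i))) P w"
    "subgame (t (c (P i))) w = Leaf (play (t (c (P i))) P)" by blast
  then show ?case using assms by (intro exI[of _ "c (P i) # w"]) auto
qed

text \<open>The root path of \<open>w\<close>. \<open>Suc t\<close> appears because the arc leaving
  the prefix of length \<open>t\<close> is named after the prefix it enters.\<close>

definition prefix_arcs :: "'k::countable list \<Rightarrow> nat list" where
  "prefix_arcs w = map (\<lambda>t. to_nat (take (Suc t) w)) [0..<length w]"

lemma prefix_arcs_snoc: "prefix_arcs (w @ [k]) = prefix_arcs w @ [to_nat (w @ [k])]"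
  by (auto simp: prefix_arcs_def)

lemma length_prefix_arcs [simp]: "length (prefix_arcs w) = length w"
  by (simp add: prefix_arcs_def)

lemma prefix_arcs_nth: "t < length w \<Longrightarrow> prefix_arcs w ! t = to_nat (take (Suc t) w)"
  by (simp add: prefix_arcs_def)

text \<open>Nodes are positions, and an arc is identified with the non-empty position it leads to.\<close>

definition game_graph :: "('n \<Rightarrow> 'a pref set) \<Rightarrow> ('n, 'a, 'k::countable) game \<Rightarrow> (nat, nat) pre_digraph" where
  "game_graph D g =
     \<lparr>verts = to_nat ` {w. is_position D g w}, arcs = to_nat ` {w. is_position D g w \<and> w \<noteq> []},
      tail = \<lambda>e. to_nat (butlast (from_nat e :: 'k list)), head = \<lambda>e. e\<rparr>"

definition game_mechanism ::
  "('n \<Rightarrow> 'a pref set) \<Rightarrow> ('n, 'a, 'k::countable) game \<Rightarrow> (nat, nat, 'n, 'a) mechanism" where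
  "game_mechanism D g =
     \<lparr>tree = game_graph D g, tree_root = to_nat ([] :: 'k list),
      LA = \<lambda>v. leaf_assignment (subgame g (from_nat v)),
      NA = \<lambda>v. mover (subgame g (from_nat v)),
      EP = \<lambda>e. let w = from_nat e in choices D (subgame g (butlast w)) (last w)\<rparr>"

locale game_form =
  fixes D :: "'n::finite \<Rightarrow> 'a pref set" and g :: "('n, 'a, 'k::countable) game"
  assumes finite_D: "finite (D i)" and D_linear: "D i \<subseteq> linear_orders"
    and obvious: "obvious_game D g"
begin

abbreviation "T \<equiv> game_graph D g"
abbreviation "G \<equiv> game_mechanism D g"

lemma game_mechanism_simps [simp]:
  "tree G = T" "tree_root G = to_nat ([] :: 'k list)"
  "LA G (to_nat w) = leaf_assignment (subgame g w)" "NA G (to_nat w) = mover (subgame g w)"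
  "EP G (to_nat (w @ [k])) = choices D (subgame g w) k"
  by (simp_all add: game_mechanism_def)

lemma game_graph_simps [simp]:
  "to_nat (w :: 'k list) \<in> verts T \<longleftrightarrow> is_position D g w"
  "to_nat (w :: 'k list) \<in> arcs T \<longleftrightarrow> is_position D g w \<and> w \<noteq> []"
  "tail T (to_nat (w :: 'k list)) = to_nat (butlast w)" "head T e = e"
  by (auto simp: game_graph_def)

lemma vertsE: "v \<in> verts T \<Longrightarrow> (\<And>w :: 'k list. v = to_nat w \<Longrightarrow> is_position D g w \<Longrightarrow> R) \<Longrightarrow> R"
  by (auto simp: game_graph_def)

lemma arcsE: "e \<in> arcs T \<Longrightarrow> (\<And>w k. e = to_nat (w @ [k :: 'k]) \<Longrightarrow> is_position D g (w @ [k]) \<Longrightarrow> R) \<Longrightarrow> R"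
  by (auto simp: game_graph_def) (metis append_butlast_last_id)

lemma is_position_butlast: "is_position D g (w @ [k]) \<Longrightarrow> is_position D g w"
  by (simp add: is_position_snoc)

sublocale fin_digraph T
proof
  show "finite (verts T)" "finite (arcs T)"
    using finite_positions[of D g] finite_D by (auto simp: game_graph_def)
qed (auto elim!: arcsE intro: is_position_butlast)

lemma walk_prefix_arcs: "is_position D g w \<Longrightarrow> awalk (to_nat ([] :: 'k list)) (prefix_arcs w) (to_nat w)"
proof (induction w rule: rev_induct)
  case Nil
  then show ?case by (simp add: prefix_arcs_def awalk_Nil_iff)
next
  case (snoc k w)
  then have "awalk (to_nat ([] :: 'k list)) (prefix_arcs w) (to_nat w)"
    by (simp add: is_position_snoc)
  moreover have "awalk (to_nat w) [to_nat (w @ [k])] (to_nat (w @ [k]))"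
    using snoc.prems by (auto simp: awalk_Cons_iff awalk_Nil_iff)
  ultimately show ?case
    by (auto simp: prefix_arcs_snoc)
qed

text \<open>The last arc is coded by \<open>w\<close> itself, so its tail is forced; hence the
  induction from the right.\<close>

lemma walk_unique:
  "awalk (to_nat ([] :: 'k list)) p (to_nat (w :: 'k list)) \<Longrightarrow> p = prefix_arcs w"
proof (induction p arbitrary: w rule: rev_induct)
  case Nil
  then show ?case by (simp add: prefix_arcs_def awalk_Nil_iff)
next
  case (snoc e p)
  then obtain v where v: "awalk (to_nat ([] :: 'k list)) p v" "awalk v [e] (to_nat w)" by auto
  then have e: "e \<in> arcs T" "v = tail T e" "e = to_nat w" by (auto simp: awalk_Cons_iff awalk_Nil_iff)
  from e(1) obtain w' k where w': "e = to_nat (w' @ [k :: 'k])" by (rule arcsE)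
  then have "w = w' @ [k]" using e(3) by simp
  moreover have "p = prefix_arcs w'" using snoc.IH v(1) e(2) w' by simp
  ultimately show ?case using w' by (simp add: prefix_arcs_snoc)
qed

lemma rooted_tree: "rooted_tree T (to_nat ([] :: 'k list))"
  unfolding rooted_tree_def
proof (intro conjI ballI)
  show "\<exists>!p. awalk (to_nat ([] :: 'k list)) p v" if "v \<in> verts T" for v
    using that by (elim vertsE) (use walk_prefix_arcs walk_unique in blast)
qed (simp_all add: fin_digraph_axioms)

lemma path_to_eq: "is_position D g w \<Longrightarrow> path_to G (to_nat w) = prefix_arcs w"
  unfolding path_to_def using walk_prefix_arcs walk_unique by (intro the_equality) auto

lemma out_arcs_eq: "is_position D g w \<Longrightarrow>
    out_arcs T (to_nat w) = (\<lambda>k. to_nat (w @ [k])) ` {k. choices D (subgame g w) k \<noteq> {}}"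
  by (auto simp: out_arcs_def is_position_snoc elim!: arcsE)

lemma leaves_iff: "to_nat w \<in> leaves G \<longleftrightarrow> is_position D g w \<and> (\<forall>k. choices D (subgame g w) k = {})"
  by (auto simp: leaves_def out_arcs_eq)

lemma passes_through_iff: "passes_through G P (to_nat w) \<longleftrightarrow> follows D g P w"
proof (induction w rule: rev_induct)
  case Nil
  then show ?case by (simp add: passes_through_def path_to_eq prefix_arcs_def)
next
  case (snoc k w)
  show ?case
  proof (cases "is_position D g (w @ [k])")
    case True
    then have "passes_through G P (to_nat (w @ [k])) \<longleftrightarrow>
        passes_through G P (to_nat w) \<and> P (mover (subgame g w)) \<in> choices D (subgame g w) k"
      using is_position_butlast[OF True] by (auto simp: passes_through_def path_to_eq prefix_arcs_snoc)
    then show ?thesis using snoc by (simp add: follows_snoc)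
  next
    case False
    then show ?thesis using follows_position[of D g P "w @ [k]"] by (auto simp: passes_through_def)
  qed
qed

end

text \<open>Non-emptiness makes exactly the \<open>Leaf\<close> positions leaves of the tree.\<close>

locale nonempty_game_form = game_form +
  assumes D_nonempty: "D i \<noteq> {}"
begin

lemma no_choices: "(\<forall>k. choices D h k = {}) \<longleftrightarrow> (\<exists>\<mu>. h = Leaf \<mu>)" for h :: "('a, 'b, 'c) game"
  using D_nonempty by (cases h) auto

lemma inner_nodesE:
  assumes "v \<in> inner_nodes G"
  obtains w i c t where "v = to_nat w" "is_position D g w" "subgame g w = Node i c t"
proof -
  obtain w :: "'c list" where w: "v = to_nat w" "is_position D g w"
    using assms by (auto simp: inner_nodes_def elim: vertsE)
  then have "\<nexists>\<mu>. subgame g w = Leaf \<mu>"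
    using assms by (auto simp: inner_nodes_def leaves_iff)
  then show ?thesis using that w by (cases "subgame g w") auto
qed

lemma no_last_move:
  assumes "is_position D g w" "subgame g w = Node i c t"
  shows "\<not> last_move G (to_nat w) s"
proof
  assume *: "last_move G (to_nat w) s"
  then have s: "s < length w" using assms by (simp add: last_move_def path_to_eq Let_def)
  then have w: "w = take s w @ w ! s # drop (Suc s) w" by (simp add: id_take_nth_drop)
  have "mover (subgame g (take s w)) \<noteq> i"
    using movers_distinct[of D g "take s w" "w ! s" "drop (Suc s) w"] assms obvious w by metis
  moreover have "NA G (tail T (path_to G (to_nat w) ! s)) = NA G (to_nat w)"
    using * by (simp add: last_move_def Let_def)
  moreover have "butlast (take (Suc s) w) = take s w" using s by (simp add: butlast_take)
  ultimately show False using assms s by (simp add: path_to_eq prefix_arcs_nth)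
qed

lemma outcome_eq:
  assumes "P \<in> Pi UNIV D"
  shows "outcome G P = play g P"
proof -
  obtain w where w: "follows D g P w" "subgame g w = Leaf (play g P)"
    using ex_leaf_position[OF assms] by blast
  have unique: "w' = w" if "follows D h P w" "follows D h P w'" "subgame h w = Leaf \<mu>" "subgame h w' = Leaf \<mu>'"
    for h :: "('a, 'b, 'c) game" and w w' \<mu> \<mu>'
    using that
  proof (induction D h P w arbitrary: w' rule: follows.induct)
    case (1 D h P)
    then show ?case by (cases w') auto
  next
    case (3 D i c t P k w)
    then show ?case by (cases w') auto
  qed auto
  have "(THE l. l \<in> leaves G \<and> passes_through G P l) = to_nat w"
  proof (rule the_equality)
    show "to_nat w \<in> leaves G \<and> passes_through G P (to_nat w)"
      using w by (simp add: leaves_iff passes_through_iff no_choices follows_position)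
    fix l assume l: "l \<in> leaves G \<and> passes_through G P l"
    then have "l \<in> verts T" by (simp add: leaves_def)
    then obtain w' :: "'c list" where "l = to_nat w'" by (rule vertsE)
    then show "l = to_nat w"
      using l unique[OF w(1) _ w(2)] by (auto simp: leaves_iff passes_through_iff no_choices)
  qed
  then show ?thesis by (simp add: outcome_def w)
qed

lemma is_mechanism: "is_mechanism D G"
  unfolding is_mechanism_def
proof (intro conjI ballI impI allI)
  show "rooted_tree (tree G) (tree_root G)" by (simp add: rooted_tree)
next
  fix l assume l: "l \<in> leaves G"
  then have "l \<in> verts T" by (simp add: leaves_def)
  then obtain w :: "'c list" where w: "l = to_nat w" "is_position D g w" by (rule vertsE)
  then obtain \<mu> where "subgame g w = Leaf \<mu>" using l by (auto simp: leaves_iff no_choices)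
  then show "is_allocation (LA G l)" using obvious_subgame[OF w(2) obvious] w by simp
next
  fix e assume "e \<in> arcs (tree G)"
  then obtain w k where e: "e = to_nat (w @ [k])" "is_position D g (w @ [k])" by (auto elim: arcsE)
  then show "EP G e \<noteq> {}" by (simp add: is_position_snoc)
  show "EP G e \<subseteq> linear_orders" using D_linear by (cases "subgame g w") (auto simp: e)
next
  fix e e' assume "e \<in> arcs (tree G)" "e' \<in> arcs (tree G)" "e \<noteq> e' \<and> tail (tree G) e = tail (tree G) e'"
  then obtain w k k' where "e = to_nat (w @ [k :: 'c])" "e' = to_nat (w @ [k'])" "k \<noteq> k'"
    by (auto elim!: arcsE)
  then show "EP G e \<inter> EP G e' = {}" by (cases "subgame g w") auto
next
  fix v s assume "v \<in> inner_nodes G" "last_move G v s"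
  then show "(\<Union>e \<in> out_arcs (tree G) v. EP G e) = EP G (path_to G v ! s)"
    using no_last_move by (auto elim!: inner_nodesE)
next
  fix v assume "v \<in> inner_nodes G"
  then obtain w i c t where v: "v = to_nat w" "is_position D g w" "subgame g w = Node i c t"
    by (rule inner_nodesE)
  then show "(\<Union>e \<in> out_arcs (tree G) v. EP G e) = D (NA G v)"
    by (auto simp: out_arcs_eq)
qed

lemma is_SOSP: "is_SOSP D G"
  unfolding is_SOSP_def
proof (intro allI ballI impI)
  fix i v P P' P''
  assume v: "v \<in> inner_nodes G" "NA G v = i"
    and P: "P \<in> Pi UNIV D" "P' \<in> Pi UNIV D" "P'' \<in> Pi UNIV D"
    and *: "passes_through G P v \<and> passes_through G P' v \<and> passes_through G P'' v \<and>
      \<not> diverge G v (P i) (P' i) \<and> diverge G v (P i) (P'' i)"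
  obtain w c t where w: "v = to_nat w" "is_position D g w" "subgame g w = Node i c t"
    using v by (auto elim!: inner_nodesE)
  have diverge: "diverge G v Q Q' \<longleftrightarrow> c Q \<noteq> c Q'" if "Q \<in> D i" "Q' \<in> D i" for Q Q'
    using that w by (auto simp: diverge_def out_arcs_eq)
  have PD: "P i \<in> D i" "P' i \<in> D i" "P'' i \<in> D i" using P by auto
  have "c (P i) = c (P' i)" "c (P i) \<noteq> c (P'' i)" using * PD diverge by auto
  moreover have "obvious_game D (Node i c t)" using obvious_subgame[OF w(2) obvious] by (simp only: w(3))
  ultimately have "(play (Node i c t) P' i, play (Node i c t) P'' i) \<in> (P i)\<^sup>="
    using P unfolding obvious_game.simps play.simps by blast
  moreover have "play g P' = play (Node i c t) P'" "play g P'' = play (Node i c t) P''"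
    using * play_subgame[of D g P' w] play_subgame[of D g P'' w]
    by (simp_all only: w passes_through_iff)
  ultimately show "(outcome G P' i, outcome G P'' i) \<in> (P i)\<^sup>="
    using P by (simp only: outcome_eq)
qed

end

lemma obvious_game_implements:
  fixes g :: "('n::finite, 'a, 'k::countable) game"
  assumes "\<And>i. finite (D i)" "\<And>i. D i \<subseteq> linear_orders" "\<And>i. D i \<noteq> {}" "obvious_game D g"
    "\<And>P. P \<in> Pi UNIV D \<Longrightarrow> f P = play g P"
  shows "SOSP_implementable D f"
proof -
  interpret nonempty_game_form D g by unfold_locales (use assms in auto)
  show ?thesis
    unfolding SOSP_implementable_def using is_mechanism is_SOSP outcome_eq assms(5) by metis
qed

section \<open>Two owners and three objects rule out SOSP\<close>

text \<open>The pair will be the objects of the other two of three owners. Their mutual order stays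
  free, so that the agent can ask for either of them.\<close>

definition top_two :: "'a \<Rightarrow> 'a \<Rightarrow> 'a pref set" where
  "top_two x y = {Q \<in> all_acceptable. \<forall>z. z \<notin> {Some x, Some y} \<longrightarrow> (Some x, z) \<in> Q \<and> (Some y, z) \<in> Q}"

lemma top_two_commute: "top_two x y = top_two y x"
  by (auto simp: top_two_def)

lemma raise_raise_top_two:
  assumes "Q \<in> all_acceptable"
  shows "raise x (raise y Q) \<in> top_two x y"
  using assms by (auto simp: top_two_def raise_all_acceptable) (auto simp: raise_def)

lemma raise_raise_top_two':
  assumes "Q \<in> all_acceptable"
  shows "raise y (raise x Q) \<in> top_two x y"
  using raise_raise_top_two[OF assms] top_two_commute by metis

lemma favourite_top_two:
  fixes Q :: "'a::finite pref"
  assumes "Q \<in> top_two x y" "x \<in> X" "y \<in> X"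
  shows "favourite Q X \<in> {x, y}"
proof (rule ccontr)
  have Q: "Q \<in> all_acceptable" and X: "X \<noteq> {}" using assms by (auto simp: top_two_def)
  assume *: "favourite Q X \<notin> {x, y}"
  then have "(Some x, Some (favourite Q X)) \<in> Q" using assms(1) by (auto simp: top_two_def)
  moreover have "(Some (favourite Q X), Some x) \<in> Q" using favourite_above[OF Q X] assms * by auto
  ultimately show False using all_acceptable_asym[OF Q] by blast
qed

context priorities
begin

lemma result_self:
  assumes "P \<in> Pi UNIV acc_domain" "x \<in> A'" "owner prio N' x = i" "favourite (P i) A' = x" "N' \<noteq> {}"
  shows "ttc_result prio P (N', A', \<mu>) i = Some x"
proof -
  have "i \<in> N'" using owner_in[OF assms(5)] assms(3) by metis
  then have "i \<in> cycle_agents prio P N' A'"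
    using assms by (intro self_cycle) (auto simp: pointee_def)
  then show ?thesis using result_cycle[OF assms(1), of A' i N' \<mu>] assms by auto
qed

lemma result_trade:
  assumes "P \<in> Pi UNIV acc_domain" "x \<in> A'" "y \<in> A'" "N' \<noteq> {}" "owner prio N' x = i" "owner prio N' y = j"
    "favourite (P i) A' = y" "favourite (P j) A' = x"
  shows "ttc_result prio P (N', A', \<mu>) i = Some y"
proof -
  have "i \<in> N'" "j \<in> N'" using owner_in[OF assms(4)] assms(5,6) by metis+
  then have "i \<in> cycle_agents prio P N' A'"
    using assms by (intro two_cycle[of P A' i N' j]) (auto simp: pointee_def)
  then show ?thesis using result_cycle[OF assms(1), of A' i N' \<mu>] assms by auto
qed

text \<open>
  Three owners \<open>i\<close>, \<open>j\<close>, \<open>k\<close> of \<open>a\<close>, \<open>b\<close>, \<open>c\<close> each rank the other two's objects on top. If \<open>j\<close> and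
  \<open>k\<close> trade, \<open>i\<close> gets neither of these, and otherwise she can get her favourite; hence none of
  them can be the first to reveal anything.
\<close>

lemma three_owners_profiles:
  assumes abc: "a \<in> A'" "b \<in> A'" "c \<in> A'"
    and own: "owner prio N' a = i" "owner prio N' b = j" "owner prio N' c = k"
    and dist: "i \<noteq> j" "i \<noteq> k" "j \<noteq> k" and N': "N' \<noteq> {}"
    and D': "\<And>l. D' l \<subseteq> all_acceptable" "D' i = top_two b c" "D' j = top_two a c" "D' k = top_two a b"
    and P0: "P0 \<in> Pi UNIV D'"
    and fp: "\<And>P. P \<in> Pi UNIV D' \<Longrightarrow> fpttc prio P = ttc_result prio P (N', A', \<mu>)"
    and Q: "Q \<in> top_two b c"
  shows "\<exists>P\<in>Pi UNIV D'. P i = Q \<and> fpttc prio P i \<notin> {Some b, Some c}"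
    and "\<exists>P\<in>Pi UNIV D'. P i = Q \<and> fpttc prio P i \<in> {Some b, Some c}"
proof -
  have dom: "P \<in> Pi UNIV acc_domain" if "P \<in> Pi UNIV D'" for P using that D'(1) by blast
  have acc: "P0 l \<in> all_acceptable" for l using dom[OF P0] by auto
  have A': "A' \<noteq> {}" using abc by auto
  have P0': "P0 l \<in> D' l" for l using P0 by auto
  note fav = favourite_raise[OF raise_all_acceptable A'] favourite_raise[OF _ A']
  let ?P = "P0(i := Q, j := raise c (raise a (P0 j)), k := raise b (raise a (P0 k)))"
  have P: "?P \<in> Pi UNIV D'"
    using P0' Q dist raise_raise_top_two'[OF acc] by (auto simp: D')
  have "fpttc prio ?P j = Some c"
    unfolding fp[OF P]
    by (rule result_trade[OF dom[OF P] abc(2,3) N' own(2,3)]) (use dist abc acc in \<open>simp_all add: fav\<close>)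
  moreover have "fpttc prio ?P k = Some b"
    unfolding fp[OF P]
    by (rule result_trade[OF dom[OF P] abc(3,2) N' own(3,2)]) (use dist abc acc in \<open>simp_all add: fav\<close>)
  ultimately have "fpttc prio ?P i \<notin> {Some b, Some c}"
    using fpttc_inj[OF dom[OF P]] dist by blast
  then show "\<exists>P\<in>Pi UNIV D'. P i = Q \<and> fpttc prio P i \<notin> {Some b, Some c}"
    using P dist by (intro bexI[of _ ?P]) auto
  consider "favourite Q A' = b" | "favourite Q A' = c"
    using favourite_top_two[OF Q abc(2,3)] by auto
  then show "\<exists>P\<in>Pi UNIV D'. P i = Q \<and> fpttc prio P i \<in> {Some b, Some c}"
  proof cases
    case 1
    \<comment> \<open>The owner of \<open>i\<close>'s favourite now asks for \<open>a\<close>, so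
      \<open>i\<close> trades with her at once.\<close>
    let ?P = "P0(i := Q, j := raise a (raise c (P0 j)))"
    have P: "?P \<in> Pi UNIV D'"
      using P0' Q dist raise_raise_top_two[OF acc] by (auto simp: D')
    have "fpttc prio ?P i = Some b"
      unfolding fp[OF P]
      by (rule result_trade[OF dom[OF P] abc(1,2) N' own(1,2)]) (use 1 dist abc acc in \<open>simp_all add: fav\<close>)
    then show ?thesis using P dist by (intro bexI[of _ ?P]) auto
  next
    case 2
    let ?P = "P0(i := Q, k := raise a (raise b (P0 k)))"
    have P: "?P \<in> Pi UNIV D'"
      using P0' Q dist raise_raise_top_two[OF acc] by (auto simp: D')
    have "fpttc prio ?P i = Some c"
      unfolding fp[OF P]
      by (rule result_trade[OF dom[OF P] abc(1,3) N' own(1,3)]) (use 2 dist abc acc in \<open>simp_all add: fav\<close>)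
    then show ?thesis using P dist by (intro bexI[of _ ?P]) auto
  qed
qed

text \<open>With different labels, the truth \<open>Q\<close> could end in neither \<open>b\<close>
  nor \<open>c\<close> while the report \<open>Q'\<close> could end in one of them, and
  \<open>Q\<close> ranks both above everything else.\<close>

lemma three_owners_violation:
  assumes abc: "a \<in> A'" "b \<in> A'" "c \<in> A'"
    and own: "owner prio N' a = i" "owner prio N' b = j" "owner prio N' c = k"
    and dist: "i \<noteq> j" "i \<noteq> k" "j \<noteq> k" and N': "N' \<noteq> {}"
    and D': "\<And>l. D' l \<subseteq> all_acceptable" "D' i = top_two b c" "D' j = top_two a c" "D' k = top_two a b"
    and P0: "P0 \<in> Pi UNIV D'"
    and fp: "\<And>P. P \<in> Pi UNIV D' \<Longrightarrow> fpttc prio P = ttc_result prio P (N', A', \<mu>)"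
    and split: "obvious_split (fpttc prio) D' i col"
    and Q: "Q \<in> D' i" "Q' \<in> D' i"
  shows "col Q = col Q'"
proof (rule ccontr)
  assume ne: "col Q \<noteq> col Q'"
  have Q2: "Q \<in> top_two b c" "Q' \<in> top_two b c" using Q D' by auto
  note profiles = three_owners_profiles[OF abc own dist N' D' P0 fp]
  obtain P where P: "P \<in> Pi UNIV D'" "P i = Q" "fpttc prio P i \<notin> {Some b, Some c}"
    using profiles(1)[OF _ Q2(1)] by blast
  obtain P'' where P'': "P'' \<in> Pi UNIV D'" "P'' i = Q'" "fpttc prio P'' i \<in> {Some b, Some c}"
    using profiles(2)[OF _ Q2(2)] by blast
  have "(fpttc prio P i, fpttc prio P'' i) \<in> Q\<^sup>="
    using split P P'' ne unfolding obvious_split_def by blast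
  moreover have "(fpttc prio P'' i, fpttc prio P i) \<in> Q"
    using Q2(1) P(3) P''(3) by (auto simp: top_two_def)
  moreover have acc: "Q \<in> all_acceptable" using Q2 by (simp add: top_two_def)
  ultimately show False
    using all_acceptable_asym[OF acc] all_acceptable_irrefl[OF acc] by (metis UnE pair_in_Id_conv)
qed

lemma three_owners_not_SOSP:
  fixes G :: "('v, 'e, 'n, 'a) mechanism"
  assumes G: "is_mechanism acc_domain G" "is_SOSP acc_domain G" "\<forall>P\<in>Pi UNIV acc_domain. fpttc prio P = outcome G P"
    and P0: "P0 \<in> Pi UNIV acc_domain" and N': "N' \<noteq> {}"
    and fp: "\<And>P. P \<in> Pi UNIV acc_domain \<Longrightarrow> (\<And>l. l \<notin> N' \<Longrightarrow> P l = P0 l) \<Longrightarrow>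
      fpttc prio P = ttc_result prio P (N', A', \<mu>)"
    and abc: "a \<in> A'" "b \<in> A'" "c \<in> A'"
    and ne: "owner prio N' a \<noteq> owner prio N' b" "owner prio N' a \<noteq> owner prio N' c"
      "owner prio N' b \<noteq> owner prio N' c"
  shows False
proof -
  define i where "i = owner prio N' a"
  define j where "j = owner prio N' b"
  define k where "k = owner prio N' c"
  note own = i_def[symmetric] j_def[symmetric] k_def[symmetric]
  have dist: "i \<noteq> j" "i \<noteq> k" "j \<noteq> k" "j \<noteq> i" "k \<noteq> i" "k \<noteq> j"
    using ne unfolding i_def j_def k_def by auto
  have ijk: "i \<in> N'" "j \<in> N'" "k \<in> N'" using owner_in[OF N'] by (auto simp: i_def j_def k_def)
  \<comment> \<open>Everyone else has a single preference, so only the three owners can split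
    anything.\<close>
  define D' where "D' = (\<lambda>l. if l = i then top_two b c else if l = j then top_two a c
    else if l = k then top_two a b else {P0 l})"
  have acc: "P0 l \<in> all_acceptable" for l using P0 by auto
  \<comment> \<open>Both orders of each pair are recorded because the violation lemma is applied
    with each owner in the first role.\<close>
  have D': "D' i = top_two b c" "D' j = top_two a c" "D' k = top_two a b"
    "D' i = top_two c b" "D' j = top_two c a" "D' k = top_two b a"
    using dist by (auto simp: D'_def top_two_commute)
  have sub: "D' l \<subseteq> all_acceptable" for l using acc by (auto simp: D'_def top_two_def)
  let ?P1 = "P0(i := raise b (raise c (P0 i)), j := raise a (raise c (P0 j)), k := raise a (raise b (P0 k)))"
  have P1: "?P1 \<in> Pi UNIV D'"
    using raise_raise_top_two[OF acc] dist by (auto simp: D'_def)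
  have fp': "fpttc prio P = ttc_result prio P (N', A', \<mu>)" if "P \<in> Pi UNIV D'" for P
  proof (rule fp)
    show "P \<in> Pi UNIV acc_domain" using that sub by blast
    show "P l = P0 l" if "l \<notin> N'" for l
    proof -
      have "P l \<in> D' l" using \<open>P \<in> Pi UNIV D'\<close> by auto
      then show ?thesis using that ijk by (auto simp: D'_def split: if_splits)
    qed
  qed
  have Q: "?P1 i \<in> top_two b c" using Pi_mem[OF P1, of i] D'(1) by simp
  obtain P P'' where PP: "P \<in> Pi UNIV D'" "P'' \<in> Pi UNIV D'" "fpttc prio P \<noteq> fpttc prio P''"
    using three_owners_profiles[OF abc own dist(1-3) N' sub D'(1-3) P1 fp' Q] by metis
  obtain x and col :: "'a pref \<Rightarrow> 'e" where "\<exists>Q\<in>D' x. \<exists>Q'\<in>D' x. col Q \<noteq> col Q'" and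
    split: "obvious_split (fpttc prio) D' x col"
    by (rule SOSP_first_divergence[where D = acc_domain and G = G and f = "fpttc prio" and D' = D', OF G sub PP])
  then obtain Q Q' where Q: "Q \<in> D' x" "Q' \<in> D' x" "col Q \<noteq> col Q'" by blast
  then consider "x = i" | "x = j" | "x = k" by (auto simp: D'_def split: if_splits)
  then show False
  proof cases
    case 1
    then show False
      using three_owners_violation[OF abc own dist(1-3) N' sub D'(1-3) P1 fp' split[unfolded 1]] Q by blast
  next
    case 2
    then show False
      using three_owners_violation[OF abc(2,1,3) own(2,1,3) dist(4,3,2) N' sub D'(2,1,6) P1 fp' split[unfolded 2]]
        Q by blast
  next
    case 3
    then show False
      using three_owners_violation[OF abc(3,1,2) own(3,1,2) dist(5,6,1) N' sub D'(3,4,5) P1 fp' split[unfolded 3]]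
        Q by blast
  qed
qed

text \<open>
  Agent \<open>i\<close> owns \<open>a\<close> and \<open>b\<close>, agent \<open>j\<close> owns \<open>c\<close>. The orders \<open>c a b\<close>, \<open>c b a\<close>, \<open>a c b\<close> for \<open>i\<close> and
  \<open>a c b\<close>, \<open>a b c\<close>, \<open>c a b\<close> for \<open>j\<close> are such that neither agent can be the first to split them.
  All other remaining agents put \<open>c\<close> on top: whoever inherits \<open>b\<close> after \<open>i\<close> has left with \<open>a\<close>
  then exchanges it for \<open>j\<close>'s \<open>c\<close>.
\<close>

lemma two_owners_not_SOSP:
  fixes G :: "('v, 'e, 'n, 'a) mechanism"
  assumes G: "is_mechanism acc_domain G" "is_SOSP acc_domain G" "\<forall>P\<in>Pi UNIV acc_domain. fpttc prio P = outcome G P"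
    and P0: "P0 \<in> Pi UNIV acc_domain" and N': "N' \<noteq> {}"
    and fp: "\<And>P. P \<in> Pi UNIV acc_domain \<Longrightarrow> (\<And>l. l \<notin> N' \<Longrightarrow> P l = P0 l) \<Longrightarrow>
      fpttc prio P = ttc_result prio P (N', A', \<mu>)"
    and abc: "a \<in> A'" "b \<in> A'" "c \<in> A'" "a \<noteq> b" "a \<noteq> c" "b \<noteq> c"
    and own: "owner prio N' a = i" "owner prio N' b = i" "owner prio N' c = j" and ij: "i \<noteq> j"
  shows False
proof -
  have ijN: "i \<in> N'" "j \<in> N'" using owner_in[OF N'] own by metis+
  have acc: "P0 l \<in> all_acceptable" for l using P0 by auto
  define cab where "cab l = raise c (raise a (raise b (P0 l)))" for l
  define cba where "cba = raise c (raise b (raise a (P0 i)))"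
  define acb where "acb l = raise a (raise c (raise b (P0 l)))" for l
  define abc' where "abc' = raise a (raise b (raise c (P0 j)))"
  note defs = cab_def cba_def acb_def abc'_def
  define D' where "D' = (\<lambda>l. if l = i then {cab l, cba, acb l} else if l = j then {acb l, abc', cab l}
    else if l \<in> N' then {raise c (P0 l)} else {P0 l})"
  have sub: "D' l \<subseteq> all_acceptable" for l
    using acc by (auto simp: D'_def defs raise_all_acceptable)
  have D'i: "D' i = {cab i, cba, acb i}" and D'j: "D' j = {acb j, abc', cab j}"
    and D'l: "l \<in> N' \<Longrightarrow> l \<noteq> i \<Longrightarrow> l \<noteq> j \<Longrightarrow> D' l = {raise c (P0 l)}" for l
    using ij by (auto simp: D'_def)
  have favs: "favourite (cab l) X = (if c \<in> X then c else if a \<in> X then a else favourite (raise b (P0 l)) X)"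
     "favourite cba X = (if c \<in> X then c else if b \<in> X then b else favourite (raise a (P0 i)) X)"
     "favourite (acb l) X = (if a \<in> X then a else if c \<in> X then c else favourite (raise b (P0 l)) X)"
     "favourite abc' X = (if a \<in> X then a else if b \<in> X then b else favourite (raise c (P0 j)) X)"
     "favourite (raise c (P0 l)) X = (if c \<in> X then c else favourite (P0 l) X)"
    if "X \<noteq> {}" for X l
    using acc that by (simp_all add: defs favourite_raise raise_all_acceptable)
  have A': "A' \<noteq> {}" using abc by auto
  note favA = favs[OF A']
  have dom: "P \<in> Pi UNIV acc_domain" if "P \<in> Pi UNIV D'" for P using that sub by blast
  have fp': "fpttc prio P = ttc_result prio P (N', A', \<mu>)" if "P \<in> Pi UNIV D'" for P
  proof (rule fp)
    show "P l = P0 l" if "l \<notin> N'" for l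
    proof -
      have "P l \<in> D' l" using \<open>P \<in> Pi UNIV D'\<close> by auto
      then show ?thesis using that ijN by (auto simp: D'_def split: if_splits)
    qed
  qed (rule dom[OF that])
  have others: "favourite (P l) X = c"
    if "P \<in> Pi UNIV D'" "l \<in> N'" "l \<noteq> i" "l \<noteq> j" "c \<in> X" for P l X
  proof -
    have "P l \<in> D' l" using that by auto
    then have "P l = raise c (P0 l)" using D'l that by auto
    then show ?thesis using favs that by (metis empty_iff)
  qed
  have i_a: "fpttc prio P i = Some a" if "P \<in> Pi UNIV D'" "P i = acb i" for P
    unfolding fp'[OF that(1)]
    by (rule result_self[OF dom[OF that(1)] abc(1) own(1) _ N']) (simp add: favA abc that)
  have j_c: "fpttc prio P j = Some c" if "P \<in> Pi UNIV D'" "P j = cab j" for P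
    unfolding fp'[OF that(1)]
    by (rule result_self[OF dom[OF that(1)] abc(3) own(3) _ N']) (simp add: favA abc that)
  have trade: "fpttc prio P i = Some c" "fpttc prio P j = Some a"
    if "P \<in> Pi UNIV D'" "P i \<in> {cab i, cba}" "P j \<in> {acb j, abc'}" for P
  proof -
    have favi: "favourite (P i) A' = c" using that(2) favA(1,2) abc by (metis insertE singletonD)
    have favj: "favourite (P j) A' = a" using that(3) favA(3,4) abc by (metis insertE singletonD)
    show "fpttc prio P i = Some c" "fpttc prio P j = Some a"
      unfolding fp'[OF that(1)]
      using result_trade[OF dom[OF that(1)] abc(1,3) N' own(1,3) favi favj]
        result_trade[OF dom[OF that(1)] abc(3,1) N' own(3,1) favj favi] by auto
  qed
  \<comment> \<open>All remaining agents, \<open>i\<close> included, ask for \<open>c\<close>, so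
    \<open>j\<close> leaves alone with it; \<open>i\<close> still owns \<open>b\<close> and now
    ranks it first.\<close>
  have i_b: "fpttc prio P i = Some b" if P: "P \<in> Pi UNIV D'" "P i = cba" "P j = cab j" for P
  proof -
    note PD = dom[OF P(1)]
    have "cycle_agents prio P N' A' = {j}"
    proof (rule common_pointee_cycle[OF PD N' A'])
      fix l assume "l \<in> N'"
      then have "favourite (P l) A' = c"
        using others[OF P(1), of l A'] P(2,3) abc by (cases "l = i"; cases "l = j") (auto simp: favA)
      then show "pointee P N' A' l = j" by (simp add: pointee_def own)
    qed
    moreover have "favourite (P j) A' = c" using P abc by (simp add: favA)
    ultimately have "ttc_result prio P (N', A', \<mu>) =
        ttc_result prio P (N' - {j}, A' - {c}, \<mu>(j := Some c))"
      using result_step[OF PD, of "(N', A', \<mu>)"] sole_cycle_step[OF PD A'] N' A'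
      by (simp add: stopped_def)
    moreover have "ttc_result prio P (N' - {j}, A' - {c}, \<mu>(j := Some c)) i = Some b"
    proof (rule result_self[OF PD])
      show "owner prio (N' - {j}) b = i"
        using own ijN ij by (subst owner_subset[where N' = N']) auto
      have "b \<in> A' - {c}" using abc by auto
      then show "favourite (P i) (A' - {c}) = b" using P(2) by (subst P(2), subst favs) auto
    qed (use abc ijN ij in auto)
    ultimately show ?thesis by (simp add: fp'[OF P(1)])
  qed
  have j_b: "fpttc prio P j = Some b" if P: "P \<in> Pi UNIV D'" "P i = acb i" "P j = abc'" for P
  proof -
    note PD = dom[OF P(1)]
    have favi: "favourite (P i) A' = a" using P abc by (simp add: favA)
    have pi: "pointee P N' A' i = i" using favi by (simp add: pointee_def own)
    have pj: "pointee P N' A' j = i" using P abc by (simp add: pointee_def own favA)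
    have pl: "pointee P N' A' l = j" if "l \<in> N'" "l \<noteq> i" "l \<noteq> j" for l
      using others[OF P(1) that abc(3)] by (simp add: pointee_def own)
    have "l = i" if l: "l \<in> cycle_agents prio P N' A'" for l
    proof -
      have lN: "l \<in> N'" using l cycle_agents_subset[OF PD] by blast
      \<comment> \<open>Everyone points into the closed set \<open>{i, j}\<close>, and
        \<open>j\<close> points into the closed set \<open>{i}\<close>; so only \<open>i\<close> can
        be in a cycle.\<close>
      have "l \<in> {i, j}"
        using cycle_agents_closed[OF PD A' l, of "{i, j}"] pi pj pl[OF lN] by (cases "l \<in> {i, j}") auto
      moreover have "l \<noteq> j"
        using cycle_agents_closed[OF PD A' l, of "{i}"] pi pj ij by auto
      ultimately show ?thesis by auto
    qed
    then have "cycle_agents prio P N' A' = {i}" using self_cycle[OF PD A' ijN(1) pi] by blast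
    then have "ttc_result prio P (N', A', \<mu>) =
        ttc_result prio P (N' - {i}, A' - {a}, \<mu>(i := Some a))"
      using result_step[OF PD, of "(N', A', \<mu>)"] sole_cycle_step[OF PD A'] N' A' favi
      by (simp add: stopped_def)
    moreover have "ttc_result prio P (N' - {i}, A' - {a}, \<mu>(i := Some a)) j = Some b"
    proof -
      have bA: "b \<in> A' - {a}" and cA: "c \<in> A' - {a}" using abc by auto
      have N'': "N' - {i} \<noteq> {}" using ijN ij by auto
      have favj: "favourite (P j) (A' - {a}) = b"
        using bA by (subst P(3), subst favs) auto
      have ownc: "owner prio (N' - {i}) c = j"
        using own ijN ij by (subst owner_subset[where N' = N']) auto
      define k where "k = owner prio (N' - {i}) b"
      show ?thesis
      proof (cases "k = j")
        case True
        then show ?thesis using result_self[OF PD bA _ favj N''] by (simp add: k_def)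
      next
        case False
        then have "favourite (P k) (A' - {a}) = c"
          using others[OF P(1) _ _ _ cA] owner_in[OF N'', of b] by (auto simp: k_def)
        then show ?thesis using result_trade[OF PD cA bA N'' ownc k_def[symmetric] favj] by simp
      qed
    qed
    ultimately show ?thesis by (simp add: fp'[OF P(1)])
  qed
  define prof where "prof Q R = (\<lambda>l. if l = i then Q else if l = j then R
    else if l \<in> N' then raise c (P0 l) else P0 l)" for Q R
  have prof: "prof Q R \<in> Pi UNIV D'" if "Q \<in> D' i" "R \<in> D' j" for Q R
    using that ij by (auto simp: prof_def D'_def)
  have prof_ij: "prof Q R i = Q" "prof Q R j = R" for Q R using ij by (auto simp: prof_def)
  have memi: "cab i \<in> D' i" "cba \<in> D' i" "acb i \<in> D' i" by (auto simp: D'i)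
  have memj: "acb j \<in> D' j" "abc' \<in> D' j" "cab j \<in> D' j" by (auto simp: D'j)
  have "fpttc prio (prof (acb i) (cab j)) i = Some a" "fpttc prio (prof (cab i) (acb j)) i = Some c"
    using i_a trade(1) prof memi memj prof_ij by auto
  then have ne: "fpttc prio (prof (acb i) (cab j)) \<noteq> fpttc prio (prof (cab i) (acb j))"
    using abc by (metis option.inject)
  obtain x and col :: "'a pref \<Rightarrow> 'e" where col: "\<exists>Q\<in>D' x. \<exists>Q'\<in>D' x. col Q \<noteq> col Q'"
    and split: "obvious_split (fpttc prio) D' x col"
    by (rule SOSP_first_divergence[where D = acc_domain and G = G and f = "fpttc prio" and D' = D',
          OF G sub prof[OF memi(3) memj(3)] prof[OF memi(1) memj(1)] ne])
  \<comment> \<open>Contrapositive of the split condition: if some outcome of \<open>P'' x\<close>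
    is strictly better than one that the label of \<open>P x\<close> allows, both preferences carry
    the same label.\<close>
  have no: "col (P x) = col (P' x) \<Longrightarrow> col (P x) = col (P'' x)"
    if "P \<in> Pi UNIV D'" "P' \<in> Pi UNIV D'" "P'' \<in> Pi UNIV D'"
      "(fpttc prio P'' x, fpttc prio P' x) \<in> P x" for P P' P''
  proof -
    have Px: "P x \<in> all_acceptable" using dom[OF that(1)] by auto
    then have "(fpttc prio P' x, fpttc prio P'' x) \<notin> (P x)\<^sup>="
      using that(4) all_acceptable_asym[OF Px] all_acceptable_irrefl[OF Px] by (metis UnE pair_in_Id_conv)
    then show "col (P x) = col (P' x) \<Longrightarrow> col (P x) = col (P'' x)"
      using split that unfolding obvious_split_def by blast
  qed
  have "x \<in> {i, j}"
    using col by (auto simp: D'_def split: if_splits)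
  then consider "x = i" | "x = j" by auto
  then show False
  proof cases
    case 1
    \<comment> \<open>Truthful \<open>cab\<close> may miss \<open>c\<close>, namely when
      \<open>j\<close> keeps it, while \<open>cba\<close> may obtain it.\<close>
    have cabcba: "col (cab i) = col cba"
    proof -
      let ?P = "prof (cab i) (cab j)" and ?P'' = "prof cba (acb j)"
      have "fpttc prio ?P j = Some c" "fpttc prio ?P'' i = Some c"
        using j_c trade(1) prof memi memj prof_ij by auto
      moreover have "fpttc prio ?P i \<noteq> Some c"
        using fpttc_inj[OF dom[OF prof[OF memi(1) memj(3)]]] calculation(1) ij by blast
      ultimately have "(fpttc prio ?P'' x, fpttc prio ?P x) \<in> ?P x"
        using above_raise[of "raise a (raise b (P0 i))" "fpttc prio ?P i" c] acc
        by (simp add: 1 prof_ij cab_def raise_all_acceptable)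
      then show ?thesis
        using no[OF prof[OF memi(1) memj(3)] prof[OF memi(1) memj(3)] prof[OF memi(2) memj(1)]]
        by (simp add: 1 prof_ij)
    qed
    \<comment> \<open>Sharing its label with \<open>cba\<close>, the order \<open>cab\<close> may
      now end in \<open>b\<close>; \<open>acb\<close> secures \<open>a\<close>, which
      \<open>cab\<close> ranks above \<open>b\<close>.\<close>
    have "col (cab i) = col (acb i)"
    proof -
      let ?P = "prof (cab i) (cab j)" and ?P' = "prof cba (cab j)" and ?P'' = "prof (acb i) (cab j)"
      have "fpttc prio ?P' i = Some b" "fpttc prio ?P'' i = Some a"
        using i_b i_a prof memi memj prof_ij by auto
      then have "(fpttc prio ?P'' x, fpttc prio ?P' x) \<in> ?P x"
        using abc by (simp add: 1 prof_ij cab_def in_raise)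
      then show ?thesis
        using no[OF prof[OF memi(1) memj(3)] prof[OF memi(2) memj(3)] prof[OF memi(3) memj(3)]] cabcba
        by (simp add: 1 prof_ij)
    qed
    then show False using col cabcba by (auto simp: 1 D'i)
  next
    case 2
    \<comment> \<open>Truthful \<open>acb\<close> misses \<open>a\<close> when \<open>i\<close>
      keeps it, while \<open>abc'\<close> may obtain it by trade.\<close>
    have acbabc: "col (acb j) = col abc'"
    proof -
      let ?P = "prof (acb i) (acb j)" and ?P'' = "prof (cab i) abc'"
      have "fpttc prio ?P i = Some a" "fpttc prio ?P'' j = Some a"
        using i_a trade(2) prof memi memj prof_ij by auto
      moreover have "fpttc prio ?P j \<noteq> Some a"
        using fpttc_inj[OF dom[OF prof[OF memi(3) memj(1)]]] calculation(1) ij by blast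
      ultimately have "(fpttc prio ?P'' x, fpttc prio ?P x) \<in> ?P x"
        using above_raise[of "raise c (raise b (P0 j))" "fpttc prio ?P j" a] acc
        by (simp add: 2 prof_ij acb_def raise_all_acceptable)
      then show ?thesis
        using no[OF prof[OF memi(3) memj(1)] prof[OF memi(3) memj(1)] prof[OF memi(1) memj(2)]]
        by (simp add: 2 prof_ij)
    qed
    \<comment> \<open>The shared label allows the outcome \<open>b\<close> of \<open>abc'\<close>,
      whereas \<open>cab\<close> secures \<open>c\<close>, which \<open>acb\<close> ranks above
      \<open>b\<close>.\<close>
    have "col (acb j) = col (cab j)"
    proof -
      let ?P = "prof (acb i) (acb j)" and ?P' = "prof (acb i) abc'" and ?P'' = "prof (acb i) (cab j)"
      have "fpttc prio ?P' j = Some b" "fpttc prio ?P'' j = Some c"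
        using j_b j_c prof memi memj prof_ij by auto
      then have "(fpttc prio ?P'' x, fpttc prio ?P' x) \<in> ?P x"
        using abc by (simp add: 2 prof_ij acb_def in_raise)
      then show ?thesis
        using no[OF prof[OF memi(3) memj(1)] prof[OF memi(3) memj(2)] prof[OF memi(3) memj(3)]] acbabc
        by (simp add: 2 prof_ij)
    qed
    then show False using col acbabc by (auto simp: 2 D'j)
  qed
qed

text \<open>A step with a single owner depends on her preference alone, and she then leaves. The
  first \<open>s\<close> steps thus use only preferences on which the two profiles agree.\<close>

lemma state_eq_if_sole_owners:
  assumes P: "P \<in> Pi UNIV acc_domain" and P': "P' \<in> Pi UNIV acc_domain"
    and sole: "\<And>t. t < s \<Longrightarrow> ttc_runs prio P t \<and>
      card (owner prio (remaining_agents prio P t) ` remaining_objects prio P t) = 1"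
    and eq: "\<And>l. l \<notin> remaining_agents prio P s \<Longrightarrow> P' l = P l"
  shows "ttc_state prio P' s = ttc_state prio P s"
proof -
  have "ttc_state prio P' t = ttc_state prio P t" if "t \<le> s" for t
    using that
  proof (induction t)
    case (Suc t)
    obtain N' A' \<mu> where S: "ttc_state prio P t = (N', A', \<mu>)" by (metis prod_cases3)
    have ne: "N' \<noteq> {}" "A' \<noteq> {}"
      using sole[of t] Suc.prems by (auto simp: S ttc_runs_iff stopped_def)
    have "card (owner prio N' ` A') = 1"
      using sole[of t] Suc.prems by (simp add: S remaining_agents_def remaining_objects_def)
    then obtain d where d: "owner prio N' ` A' = {d}" by (auto simp: card_1_singleton_iff)
    note steps = sole_cycle_step[OF P ne(2) sole_owner_cycle[OF P ne d]]
      sole_cycle_step[OF P' ne(2) sole_owner_cycle[OF P' ne d]]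
    have "d \<notin> remaining_agents prio P (Suc t)"
      by (simp add: remaining_agents_def ttc_state_Suc S steps)
    then have "P' d = P d"
      using remaining_agents_antimono[OF P Suc.prems] eq by blast
    then show ?case using Suc by (simp add: ttc_state_Suc S steps)
  qed (simp add: ttc_state_0)
  then show ?thesis by simp
qed

lemma SOSP_imp_weak_serial_dictatorship:
  assumes "SOSP_implementable acc_domain (fpttc prio)"
  shows "weak_serial_dictatorship prio"
proof (rule ccontr)
  assume "\<not> ?thesis"
  then obtain P where P: "P \<in> Pi UNIV acc_domain" and "\<exists>s. ttc_runs prio P s \<and>
      card (remaining_objects prio P s) > 2 \<and>
      card (owner prio (remaining_agents prio P s) ` remaining_objects prio P s) \<noteq> 1"
    unfolding weak_serial_dictatorship_def by blast
  then obtain s where s: "ttc_runs prio P s" "card (remaining_objects prio P s) > 2"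
      "card (owner prio (remaining_agents prio P s) ` remaining_objects prio P s) \<noteq> 1"
    and least: "\<And>t. t < s \<Longrightarrow> \<not> (ttc_runs prio P t \<and>
      card (remaining_objects prio P t) > 2 \<and>
      card (owner prio (remaining_agents prio P t) ` remaining_objects prio P t) \<noteq> 1)"
    using exists_least_iff[of "\<lambda>s. ttc_runs prio P s \<and>
      card (remaining_objects prio P s) > 2 \<and>
      card (owner prio (remaining_agents prio P s) ` remaining_objects prio P s) \<noteq> 1"] by blast
  \<comment> \<open>Objects only disappear, so every earlier step also has more than two of them and
    minimality of \<open>s\<close> applies.\<close>
  have sole: "ttc_runs prio P t \<and>
      card (owner prio (remaining_agents prio P t) ` remaining_objects prio P t) = 1" if "t < s" for t
  proof -
    have "ttc_runs prio P t" using ttc_runs_mono[OF P s(1)] that by simp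
    moreover have "card (remaining_objects prio P s) \<le> card (remaining_objects prio P t)"
      using remaining_objects_antimono[OF P, of t s] that by (intro card_mono) auto
    ultimately show ?thesis using least[OF that] s(2) by auto
  qed
  obtain N' A' \<mu> where S: "ttc_state prio P s = (N', A', \<mu>)" by (metis prod_cases3)
  have N': "N' \<noteq> {}" using s(1) by (simp add: S ttc_runs_iff stopped_def)
  have A': "card A' > 2" and owners: "card (owner prio N' ` A') \<noteq> 1"
    using s by (simp_all add: S remaining_agents_def remaining_objects_def)
  have fp: "fpttc prio P' = ttc_result prio P' (N', A', \<mu>)"
    if P': "P' \<in> Pi UNIV acc_domain" "\<And>l. l \<notin> N' \<Longrightarrow> P' l = P l" for P'
  proof -
    have "ttc_state prio P' s = (N', A', \<mu>)"
      using state_eq_if_sole_owners[OF P P'(1), of s, OF sole] P'(2) by (simp add: S remaining_agents_def)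
    moreover from this have "ttc_runs prio P' s" using s(1) by (simp add: ttc_runs_iff S)
    ultimately show ?thesis using fpttc_eq_result_state[OF P'(1)] by metis
  qed
  obtain G :: "(nat, nat, 'n, 'a) mechanism" where
    G: "is_mechanism acc_domain G" "is_SOSP acc_domain G" "\<forall>P\<in>Pi UNIV acc_domain. fpttc prio P = outcome G P"
    using assms by (auto simp: SOSP_implementable_def)
  have "A' \<noteq> {}" using A' by auto
  then obtain x where x: "x \<in> A'" by blast
  have "\<exists>y\<in>A'. owner prio N' y \<noteq> owner prio N' x"
  proof (rule ccontr)
    assume "\<not> ?thesis"
    then have "owner prio N' ` A' = (\<lambda>_. owner prio N' x) ` A'" by (intro image_cong) auto
    also have "\<dots> = {owner prio N' x}" using x by (rule image_constant)
    finally show False using owners by simp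
  qed
  then obtain y where y: "y \<in> A'" "owner prio N' y \<noteq> owner prio N' x" by blast
  have "card {x, y} < card A'" using A' by (simp add: card_insert_if)
  then have "\<not> A' \<subseteq> {x, y}" using card_mono[of "{x, y}" A'] by auto
  then obtain z where z: "z \<in> A'" "z \<noteq> x" "z \<noteq> y" by blast
  have xy: "x \<noteq> y" using y(2) by auto
  consider "owner prio N' z = owner prio N' x" | "owner prio N' z = owner prio N' y"
    | "owner prio N' z \<noteq> owner prio N' x" "owner prio N' z \<noteq> owner prio N' y" by blast
  then show False
  proof cases
    case 1
    then show False
      using two_owners_not_SOSP[OF G P N' fp x z(1) y(1) _ xy z(3) refl 1 refl] z(2) y(2) by metis
  next
    case 2
    then show False
      using two_owners_not_SOSP[OF G P N' fp y(1) z(1) x _ _ z(2) refl 2 refl] z(3) xy y(2) by metis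
  next
    case 3
    then show False
      using three_owners_not_SOSP[OF G P N' fp x y(1) z(1)] y(2) by metis
  qed
qed

end

section \<open>A game form for weak serial dictatorships\<close>

lemma all_acceptable_nonempty: "(all_acceptable :: 'a::finite pref set) \<noteq> {}"
proof -
  \<comment> \<open>Lexicographic ranks: the first component puts the outside option last, the
    second orders the objects by their codes.\<close>
  let ?r = "\<lambda>x :: 'a option. case x of None \<Rightarrow> (1, 0) | Some a \<Rightarrow> (0 :: nat, to_nat a)"
  let ?Q = "{(x, y). fst (?r x) < fst (?r y) \<or> fst (?r x) = fst (?r y) \<and> snd (?r x) < snd (?r y)}"
  have "trans ?Q" "irrefl ?Q" "total ?Q"
    by (auto simp: trans_def irrefl_def total_on_def linorder_neq_iff[symmetric] split: option.splits)
  then have "?Q \<in> all_acceptable"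
    by (auto simp: all_acceptable_def linear_orders_def strict_linear_order_on_def)
  then show ?thesis by blast
qed

context priorities
begin

text \<open>The bound on the movers carries the induction: a dictator has been removed from the
  state of the continuation, so she does not move there again.\<close>

definition plays_ttc :: "('n, 'a) ttc_state \<Rightarrow> ('n, 'a, 'a) game \<Rightarrow> bool" where
  "plays_ttc S g \<longleftrightarrow> obvious_game acc_domain g \<and> movers acc_domain g \<subseteq> fst S \<and>
     (\<forall>P \<in> Pi UNIV acc_domain. play g P = ttc_result prio P S)"

lemma plays_stopped:
  assumes "stopped S" "valid_state S"
  shows "plays_ttc S (Leaf (snd (snd S)))"
  using assms by (auto simp: plays_ttc_def result_stopped valid_state_def is_allocation_iff split: prod.splits)

text \<open>Whatever follows, \<open>d\<close> ends up with exactly the object she names, so naming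
  her favourite is obviously best.\<close>

lemma plays_dictator:
  assumes "N' \<noteq> {}" "A' \<noteq> {}" "owner prio N' ` A' = {d}"
    and t: "\<And>a. a \<in> A' \<Longrightarrow> plays_ttc (N' - {d}, A' - {a}, \<mu>(d := Some a)) (t a)"
  shows "plays_ttc (N', A', \<mu>) (Node d (\<lambda>Q. favourite Q A') t)"
proof -
  have d: "d \<in> N'" using owner_in[OF assms(1)] assms(3) by (metis imageE singletonI)
  have fav: "favourite Q A' \<in> A'" if "Q \<in> all_acceptable" for Q
    using favourite_in that assms(2) by blast
  have play: "play (t a) P = ttc_result prio P (N' - {d}, A' - {a}, \<mu>(d := Some a))"
    if "P \<in> Pi UNIV acc_domain" "a \<in> A'" for P a
    using t[OF that(2)] that(1) by (simp add: plays_ttc_def)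
  have play_d: "play (t a) P d = Some a" if "P \<in> Pi UNIV acc_domain" "a \<in> A'" for P a
    using play[OF that] result_removed[OF that(1)] by simp
  have "obvious_game acc_domain (Node d (\<lambda>Q. favourite Q A') t)"
    unfolding obvious_game.simps
  proof (intro conjI ballI impI)
    fix k assume "k \<in> (\<lambda>Q. favourite Q A') ` acc_domain d"
    then have "plays_ttc (N' - {d}, A' - {k}, \<mu>(d := Some k)) (t k)" using fav t by blast
    then show "d \<notin> movers acc_domain (t k)" "obvious_game acc_domain (t k)" by (auto simp: plays_ttc_def)
  next
    fix P P' P'' assume P: "P \<in> Pi UNIV acc_domain" "P' \<in> Pi UNIV acc_domain" "P'' \<in> Pi UNIV acc_domain"
      and f: "favourite (P d) A' = favourite (P' d) A' \<and> favourite (P d) A' \<noteq> favourite (P'' d) A'"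
    have "P d \<in> all_acceptable" "P' d \<in> all_acceptable" "P'' d \<in> all_acceptable" using P by auto
    then show "(play (t (favourite (P' d) A')) P' d, play (t (favourite (P'' d) A')) P'' d) \<in> (P d)\<^sup>="
      using f fav play_d P favourite_above[of "P d" A' "favourite (P'' d) A'"] assms(2) by auto
  qed
  moreover have "movers acc_domain (t k) \<subseteq> N'" if "k \<in> (\<lambda>Q. favourite Q A') ` acc_domain d" for k
    using that t fav unfolding plays_ttc_def by fastforce
  then have "movers acc_domain (Node d (\<lambda>Q. favourite Q A') t) \<subseteq> N'" using d by auto
  moreover have "play (Node d (\<lambda>Q. favourite Q A') t) P = ttc_result prio P (N', A', \<mu>)"
    if P: "P \<in> Pi UNIV acc_domain" for P
  proof -
    have "favourite (P d) A' \<in> A'" using P fav by auto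
    then show ?thesis
      using play[OF P] result_step[OF P, of "(N', A', \<mu>)"] assms
        sole_cycle_step[OF P assms(2) sole_owner_cycle[OF P assms(1-3)]]
      by (simp add: stopped_def)
  qed
  ultimately show ?thesis unfolding plays_ttc_def fst_conv by blast
qed

text \<open>Only \<open>i\<close> is in a cycle. After she leaves with \<open>a\<close>, the last
  object \<open>b\<close> is still owned by \<open>j\<close>, who takes it.\<close>

lemma result_same_favourite:
  assumes P: "P \<in> Pi UNIV acc_domain" and A': "A' = {a, b}" "a \<noteq> b" and N': "N' \<noteq> {}"
    and own: "owner prio N' a = i" "owner prio N' b = j" and ij: "i \<noteq> j"
    and fav: "favourite (P i) A' = a" "favourite (P j) A' = a"
  shows "ttc_result prio P (N', A', \<mu>) = \<mu>(i := Some a, j := Some b)"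
proof -
  have ne: "A' \<noteq> {}" using A' by auto
  have acc: "P l \<in> all_acceptable" for l using P by auto
  have ijN: "i \<in> N'" "j \<in> N'" using owner_in[OF N'] own by metis+
  have pointee: "pointee P N' A' l \<in> {i, j}" for l
    using favourite_in[OF acc[of l] ne] own by (auto simp: pointee_def A')
  have p: "pointee P N' A' i = i" "pointee P N' A' j = i" using fav own by (simp_all add: pointee_def)
  have "l = i" if l: "l \<in> cycle_agents prio P N' A'" for l
  proof -
    have "l \<in> {i, j}" using cycle_agents_closed[OF P ne l, of "{i, j}"] pointee by blast
    moreover have "l \<noteq> j" using cycle_agents_closed[OF P ne l, of "{i}"] p ij by auto
    ultimately show ?thesis by auto
  qed
  then have C: "cycle_agents prio P N' A' = {i}" using self_cycle[OF P ne ijN(1) p(1)] by blast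
  have "ttc_result prio P (N', A', \<mu>) = ttc_result prio P (N' - {i}, {b}, \<mu>(i := Some a))"
    using result_step[OF P, of "(N', A', \<mu>)"] sole_cycle_step[OF P ne C] N' ne fav A'
    by (simp add: stopped_def insert_Diff_if)
  also have "\<dots> = ttc_result prio P (N' - {i} - {j}, {}, \<mu>(i := Some a, j := Some b))"
  proof -
    have N'': "N' - {i} \<noteq> {}" using ijN ij by auto
    have own': "owner prio (N' - {i}) ` {b} = {j}"
      using own ijN ij by (simp, subst owner_subset[where N' = N']) auto
    have "favourite (P j) {b} = b" using favourite_in[OF acc[of j], of "{b}"] by simp
    then show ?thesis
      using result_step[OF P, of "(N' - {i}, {b}, \<mu>(i := Some a))"] N''
        sole_cycle_step[OF P _ sole_owner_cycle[OF P N'' _ own']]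
      by (simp add: stopped_def)
  qed
  also have "\<dots> = \<mu>(i := Some a, j := Some b)" by (simp add: result_stopped stopped_def)
  finally show ?thesis .
qed

lemma result_two_owners:
  assumes P: "P \<in> Pi UNIV acc_domain" and A': "A' = {a, b}" "a \<noteq> b" and N': "N' \<noteq> {}"
    and own: "owner prio N' a = i" "owner prio N' b = j" and ij: "i \<noteq> j"
  shows "ttc_result prio P (N', A', \<mu>) = (if favourite (P i) A' = b \<and> favourite (P j) A' = a
    then \<mu>(i := Some b, j := Some a) else \<mu>(i := Some a, j := Some b))"
proof -
  have ne: "A' \<noteq> {}" using A' by auto
  have acc: "P l \<in> all_acceptable" for l using P by auto
  have ijN: "i \<in> N'" "j \<in> N'" using owner_in[OF N'] own by metis+
  have fav: "favourite (P l) A' = a \<or> favourite (P l) A' = b" for l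
    using favourite_in[OF acc[of l] ne] by (auto simp: A')
  have pointee: "pointee P N' A' l \<in> {i, j}" for l
    using fav[of l] own by (auto simp: pointee_def)
  have C: "cycle_agents prio P N' A' \<subseteq> {i, j}"
    using cycle_agents_closed[OF P ne, where X = "{i, j}"] pointee by blast
  \<comment> \<open>Owners with different favourites are both in cycles, two self-loops or one swap,
    and the step exhausts \<open>A'\<close>.\<close>
  have both: "ttc_result prio P (N', A', \<mu>) = \<mu>(i := Some x, j := Some y)"
    if xy: "favourite (P i) A' = x" "favourite (P j) A' = y" "{x, y} = {a, b}" for x y
  proof -
    have "i \<in> cycle_agents prio P N' A' \<and> j \<in> cycle_agents prio P N' A'"
    proof (cases "x = a")
      case True
      then have "y = b" using xy(3) A'(2) by (auto simp: doubleton_eq_iff)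
      then have "pointee P N' A' i = i" "pointee P N' A' j = j"
        using True xy own by (simp_all add: pointee_def)
      then show ?thesis using self_cycle[OF P ne] ijN by simp
    next
      case False
      then have "x = b" "y = a" using xy(3) by (auto simp: doubleton_eq_iff)
      then have "pointee P N' A' i = j" "pointee P N' A' j = i"
        using xy own by (simp_all add: pointee_def)
      then show ?thesis using two_cycle[OF P ne] ijN by simp
    qed
    then have Cij: "cycle_agents prio P N' A' = {i, j}" using C by blast
    have "A' - (\<lambda>l. favourite (P l) A') ` {i, j} = {}" using xy by (auto simp: A')
    then have "ttc_step prio P (N', A', \<mu>) = (N' - {i, j}, {}, \<mu>(i := Some x, j := Some y))"
      using xy by (auto simp: ttc_step_eq[OF P ne] Cij Let_def)
    then show ?thesis
      using result_step[OF P, of "(N', A', \<mu>)"] N' ne by (simp add: stopped_def result_stopped)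
  qed
  have A'': "A' = {b, a}" using A' by auto
  consider "favourite (P i) A' = a" "favourite (P j) A' = a" | "favourite (P i) A' = a" "favourite (P j) A' = b"
    | "favourite (P i) A' = b" "favourite (P j) A' = a" | "favourite (P i) A' = b" "favourite (P j) A' = b"
    using fav by blast
  then show ?thesis
  proof cases
    case 1
    then show ?thesis using result_same_favourite[OF P A' N' own ij] A'(2) by simp
  next
    case 2
    then show ?thesis using both[OF 2] A'(2) by auto
  next
    case 3
    then show ?thesis using both[OF 3] A'(2) by auto
  next
    case 4
    then show ?thesis
      using result_same_favourite[OF P A'' A'(2)[symmetric] N' own(2,1) ij[symmetric] 4(2,1)] A'(2) ij
      by (simp add: fun_upd_twist)
  qed
qed

text \<open>If \<open>i\<close> wants \<open>a\<close>, keeping secures it; if she wants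
  \<open>b\<close>, offering ends at worst in \<open>a\<close>, which keeping would yield anyway.
  The answer of \<open>j\<close> determines her own object outright.\<close>

lemma plays_two_owners:
  assumes valid: "valid_state (N', A', \<mu>)" and A': "A' = {a, b}" "a \<noteq> b" and N': "N' \<noteq> {}"
    and own: "owner prio N' a = i" "owner prio N' b = j" and ij: "i \<noteq> j"
  shows "\<exists>g. plays_ttc (N', A', \<mu>) g"
proof -
  have ne: "A' \<noteq> {}" using A' by auto
  have ijN: "i \<in> N'" "j \<in> N'" using owner_in[OF N'] own by metis+
  let ?\<mu>1 = "\<mu>(i := Some a, j := Some b)" and ?\<mu>2 = "\<mu>(i := Some b, j := Some a)"
  let ?h = "Node j (\<lambda>Q. favourite Q A') (\<lambda>k. if k = a then Leaf ?\<mu>2 else Leaf ?\<mu>1)"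
  let ?g = "Node i (\<lambda>Q. favourite Q A') (\<lambda>k. if k = a then Leaf ?\<mu>1 else ?h)"
  have alloc: "is_allocation ?\<mu>1" "is_allocation ?\<mu>2"
    using valid ij A'(2) by (auto simp: valid_state_def is_allocation_iff A'(1))
  have fav: "favourite Q A' = a \<and> (Some a, Some b) \<in> Q \<or> favourite Q A' = b \<and> (Some b, Some a) \<in> Q"
    if "Q \<in> all_acceptable" for Q
    using favourite_in[OF that ne] favourite_above[OF that ne] A' by auto
  have favP: "favourite (P l) A' = a \<and> (Some a, Some b) \<in> P l \<or> favourite (P l) A' = b \<and> (Some b, Some a) \<in> P l"
    if "P \<in> Pi UNIV acc_domain" for P l
    using that by (intro fav) auto
  have h: "obvious_game acc_domain ?h"
    unfolding obvious_game.simps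
  proof (intro conjI ballI impI)
    fix P P' P'' assume "P \<in> Pi UNIV acc_domain" "P' \<in> Pi UNIV acc_domain" "P'' \<in> Pi UNIV acc_domain"
      "favourite (P j) A' = favourite (P' j) A' \<and> favourite (P j) A' \<noteq> favourite (P'' j) A'"
    then show "(play (if favourite (P' j) A' = a then Leaf ?\<mu>2 else Leaf ?\<mu>1) P' j,
        play (if favourite (P'' j) A' = a then Leaf ?\<mu>2 else Leaf ?\<mu>1) P'' j) \<in> (P j)\<^sup>="
      using favP[of P j] favP[of P' j] favP[of P'' j] A'(2) by auto
  qed (use alloc in auto)
  have "obvious_game acc_domain ?g"
    unfolding obvious_game.simps(2)[of _ i]
  proof (intro conjI ballI impI)
    fix k
    show "i \<notin> movers acc_domain (if k = a then Leaf ?\<mu>1 else ?h)" using ij by simp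
    show "obvious_game acc_domain (if k = a then Leaf ?\<mu>1 else ?h)"
      using alloc(1) h by (simp del: obvious_game.simps(2))
  next
    fix P P' P'' assume "P \<in> Pi UNIV acc_domain" "P' \<in> Pi UNIV acc_domain" "P'' \<in> Pi UNIV acc_domain"
      "favourite (P i) A' = favourite (P' i) A' \<and> favourite (P i) A' \<noteq> favourite (P'' i) A'"
    then show "(play (if favourite (P' i) A' = a then Leaf ?\<mu>1 else ?h) P' i,
        play (if favourite (P'' i) A' = a then Leaf ?\<mu>1 else ?h) P'' i) \<in> (P i)\<^sup>="
      using favP[of P i] favP[of P' i] favP[of P'' i] favP[of P' j] favP[of P'' j] A'(2) ij by auto
  qed
  moreover have "movers acc_domain ?g \<subseteq> N'" using ijN by (auto split: if_splits)
  moreover have "play ?g P = ttc_result prio P (N', A', \<mu>)" if P: "P \<in> Pi UNIV acc_domain" for P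
    using favP[OF P, of i] favP[OF P, of j] A'(2)
    by (auto simp: result_two_owners[OF P A' N' own ij])
  ultimately show ?thesis unfolding plays_ttc_def fst_conv by blast
qed

text \<open>Records a profile at which the state really occurs, since
  \<open>weak_serial_dictatorship\<close> says nothing about other states.\<close>

definition reached_by_dictators :: "('n, 'a) ttc_state \<Rightarrow> bool" where
  "reached_by_dictators S \<longleftrightarrow> (\<exists>P \<in> Pi UNIV acc_domain. \<exists>s. ttc_state prio P s = S \<and>
     (\<forall>t<s. ttc_runs prio P t \<and>
        card (owner prio (remaining_agents prio P t) ` remaining_objects prio P t) = 1))"

text \<open>The witness profile is changed by letting \<open>d\<close> rank \<open>a\<close> first.
  As \<open>d\<close> is still present, her preference has not influenced the earlier
  states.\<close>

lemma reached_by_dictators_step: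
  assumes reached: "reached_by_dictators (N', A', \<mu>)"
    and ne: "N' \<noteq> {}" "A' \<noteq> {}" and d: "owner prio N' ` A' = {d}" and a: "a \<in> A'"
  shows "reached_by_dictators (N' - {d}, A' - {a}, \<mu>(d := Some a))"
proof -
  obtain P s where P: "P \<in> Pi UNIV acc_domain" and S: "ttc_state prio P s = (N', A', \<mu>)"
    and sole: "\<And>t. t < s \<Longrightarrow> ttc_runs prio P t \<and>
      card (owner prio (remaining_agents prio P t) ` remaining_objects prio P t) = 1"
    using reached unfolding reached_by_dictators_def by blast
  have accP: "P l \<in> all_acceptable" for l using P by auto
  note acc = accP[of d]
  let ?P = "P(d := raise a (P d))"
  have P': "?P \<in> Pi UNIV acc_domain" using accP raise_all_acceptable[OF acc] by auto
  have "d \<in> N'" using owner_in[OF ne(1)] d by (metis imageE singletonI)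
  then have "d \<in> remaining_agents prio P t" if "t \<le> s" for t
    using remaining_agents_antimono[OF P that] S by (auto simp: remaining_agents_def)
  then have eq: "ttc_state prio ?P t = ttc_state prio P t" if "t \<le> s" for t
    using that by (intro state_eq_if_sole_owners[OF P P' sole]) auto
  have "favourite (?P d) A' = a" using a acc by (simp add: favourite_raise ne)
  then have "ttc_state prio ?P (Suc s) = (N' - {d}, A' - {a}, \<mu>(d := Some a))"
    using sole_cycle_step[OF P' ne(2) sole_owner_cycle[OF P' ne d]] eq[of s] S
    by (simp add: ttc_state_Suc)
  moreover have "ttc_runs prio ?P t \<and>
      card (owner prio (remaining_agents prio ?P t) ` remaining_objects prio ?P t) = 1" if "t < Suc s" for t
  proof (cases "t = s")
    case True
    then show ?thesis
      using eq[of s] S d ne by (simp add: ttc_runs_iff stopped_def remaining_agents_def remaining_objects_def)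
  next
    case False
    then show ?thesis
      using eq[of t] sole[of t] that by (simp add: ttc_runs_iff remaining_agents_def remaining_objects_def)
  qed
  ultimately show ?thesis unfolding reached_by_dictators_def using P' by blast
qed

text \<open>Reachability is carried while more than two objects remain, the range in which the
  assumption on \<open>prio\<close> restricts the owners. Several owners can then occur only with
  exactly two objects.\<close>

lemma ex_plays_ttc:
  assumes wsd: "weak_serial_dictatorship prio"
    and "valid_state (N', A', \<mu>)" "card A' > 2 \<Longrightarrow> reached_by_dictators (N', A', \<mu>)"
  shows "\<exists>g. plays_ttc (N', A', \<mu>) g"
  using assms(2,3)
proof (induction "card A'" arbitrary: N' A' \<mu> rule: less_induct)
  case less
  show ?case
  proof (cases "stopped (N', A', \<mu>)")
    case True
    then show ?thesis using plays_stopped less.prems(1) by blast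
  next
    case False
    then have ne: "N' \<noteq> {}" "A' \<noteq> {}" by (auto simp: stopped_def)
    show ?thesis
    proof (cases "card (owner prio N' ` A') = 1")
      case True
      then obtain d where d: "owner prio N' ` A' = {d}" by (auto simp: card_1_singleton_iff)
      have "\<exists>g. plays_ttc (N' - {d}, A' - {a}, \<mu>(d := Some a)) g" if a: "a \<in> A'" for a
      proof (rule less.hyps)
        show less_card: "card (A' - {a}) < card A'" using a by (intro card_Diff1_less) auto
        obtain Q :: "'a pref" where Q: "Q \<in> all_acceptable" using all_acceptable_nonempty by blast
        \<comment> \<open>An auxiliary profile at which \<open>d\<close> picks \<open>a\<close>; it
          exhibits the next state as a \<open>ttc_step\<close>, so that validity is
          inherited.\<close>
        let ?P = "\<lambda>_ :: 'n. raise a Q"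
        have P: "?P \<in> Pi UNIV acc_domain" using Q raise_all_acceptable by auto
        have "ttc_step prio ?P (N', A', \<mu>) = (N' - {d}, A' - {a}, \<mu>(d := Some a))"
          using sole_cycle_step[OF P ne(2) sole_owner_cycle[OF P ne d]] Q a
          by (simp add: favourite_raise ne)
        then show "valid_state (N' - {d}, A' - {a}, \<mu>(d := Some a))"
          using valid_step[OF P less.prems(1) False] by simp
        show "reached_by_dictators (N' - {d}, A' - {a}, \<mu>(d := Some a))" if "card (A' - {a}) > 2"
          using reached_by_dictators_step[OF less.prems(2) ne d a] less_card that by simp
      qed
      then obtain t where "\<And>a. a \<in> A' \<Longrightarrow> plays_ttc (N' - {d}, A' - {a}, \<mu>(d := Some a)) (t a)"
        by metis
      then show ?thesis using plays_dictator[OF ne d] by blast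
    next
      case owners: False
      have "card A' \<le> 2"
      proof (rule ccontr)
        assume *: "\<not> card A' \<le> 2"
        then obtain P s where P: "P \<in> Pi UNIV acc_domain" "ttc_state prio P s = (N', A', \<mu>)"
          using less.prems(2) by (auto simp: reached_by_dictators_def)
        then have "ttc_runs prio P s" "card (remaining_objects prio P s) > 2"
          using False * by (simp_all add: ttc_runs_iff remaining_objects_def)
        then have "card (owner prio (remaining_agents prio P s) ` remaining_objects prio P s) = 1"
          using wsd P(1) unfolding weak_serial_dictatorship_def by blast
        then show False using owners P(2) by (simp add: remaining_agents_def remaining_objects_def)
      qed
      moreover have "card A' \<noteq> 0" using ne by simp
      moreover have "card A' \<noteq> 1" using owners by (auto simp: card_1_singleton_iff)
      ultimately have "card A' = 2" by linarith
      then obtain a b where ab: "A' = {a, b}" "a \<noteq> b" by (auto simp: card_2_iff)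
      have "owner prio N' a \<noteq> owner prio N' b" using owners by (auto simp: ab)
      then show ?thesis using plays_two_owners[OF less.prems(1) ab ne(1) refl refl] by blast
    qed
  qed
qed

lemma weak_serial_dictatorship_imp_SOSP:
  assumes "weak_serial_dictatorship prio"
  shows "SOSP_implementable acc_domain (fpttc prio)"
proof -
  obtain Q :: "'a pref" where Q: "Q \<in> all_acceptable" using all_acceptable_nonempty by blast
  have "reached_by_dictators (UNIV, UNIV, \<lambda>_. None)"
    unfolding reached_by_dictators_def
    by (rule bexI[of _ "\<lambda>_. Q"], rule exI[of _ 0]) (use Q in \<open>auto simp: ttc_state_0\<close>)
  then obtain g where g: "plays_ttc (UNIV, UNIV, \<lambda>_. None) g"
    using ex_plays_ttc[OF assms, of UNIV UNIV "\<lambda>_. None"] by (auto simp: valid_state_def)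
  show ?thesis
  proof (rule obvious_game_implements)
    show "fpttc prio P = play g P" if "P \<in> Pi UNIV acc_domain" for P
      using g that by (simp add: plays_ttc_def fpttc_eq_result)
    show "obvious_game acc_domain g" using g by (simp add: plays_ttc_def)
  qed (auto simp: all_acceptable_nonempty all_acceptable_linear)
qed

end

theorem theorem5p1:
  fixes prio :: "'a::finite \<Rightarrow> ('n::finite) rel"
  assumes "priority_structure prio"
  shows "SOSP_implementable (\<lambda>_. all_acceptable) (fpttc prio) \<longleftrightarrow> weak_serial_dictatorship prio"
proof -
  interpret priorities prio by unfold_locales (rule assms)
  show ?thesis using SOSP_imp_weak_serial_dictatorship weak_serial_dictatorship_imp_SOSP by blast
qed

end
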